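(* Let $\omega>0$ and consider the differential system $$\dot x=-\nu(\varepsilon)\,(x^3-\mu(\varepsilon) x-y),\qquad \dot y=-h(\varepsilon) z+k(\varepsilon) x-\alpha(\varepsilon) y,\qquad \dot z=\beta(\varepsilon) y,$$ whose real coefficients depend smoothly on $\varepsilon$, with Taylor coefficients at $\varepsilon=0$ denoted $h_i,k_i,\alpha_i,\beta_i,\mu_i,\nu_i$ ($i\ge0$). Assume that one of the following four hypotheses holds. (H$_1$) $h_0=0$, $k_0=-\dfrac{\mu_0^2\nu_0^2+\omega^2}{\nu_0}$, $\alpha_0=\mu_0\nu_0$, and, with $\delta_1=\omega^2(\mu_0\nu_1-\alpha_1+\mu_1\nu_0)-\beta_0h_1\mu_0\nu_0$, one has $\delta_1\nu_0>0$ and $\beta_0h_1\mu_0\neq0$. (H$_2$) $\beta_0=0$, $k_0=-\dfrac{\mu_0^2\nu_0^2+\omega^2}{\nu_0}$, $\alpha_0=\mu_0\nu_0$, and, with $\delta_2=\omega^2(\mu_0\nu_1-\alpha_1+\mu_1\nu_0)-\beta_1h_0\mu_0\nu_0$, one has $\delta_2\nu_0>0$ and $\beta_1h_0\mu_0\neq0$. (H$_3$) $\alpha_0=0$, $\beta_0=\dfrac{\omega^2}{h_0}$, $\nu_0=0$, $\alpha_1=0$, $\mu_0=0$, $\alpha_2=0$, and, with $\delta_3=\sqrt{\mu_1}\,(h_1k_0-h_0k_1)\,h_0\,\omega$, one has $\delta_3>0$ and $2k_0\mu_1\nu_1^2-\alpha_3\omega^2\neq0$. (H$_4$) $\alpha_0=0$,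 $k_0=-\dfrac{\omega^2}{\nu_0}$, $h_0=0$, $\mu_0=0$, and, with $\delta_4=\nu_0(\mu_1\nu_0-\alpha_1)$, one has $\delta_4>0$ and $\beta_0h_1(2\alpha_1^2-3\alpha_1\mu_1\nu_0+\mu_1^2\nu_0^2)\neq0$. Then for $\varepsilon>0$ sufficiently small the system has a periodic solution emerging from the origin of coordinates.
   Context: For each coefficient, the subscript $i$ denotes its $i$-th Taylor coefficient in $\varepsilon$ at $\varepsilon=0$ (e.g. $\mu(\varepsilon)=\sum_{i=0}^{N}\varepsilon^i\mu_i+\mathcal O(\varepsilon^{N+1})$). A periodic solution $\varphi(t,\varepsilon)$ emerges from the origin if $\varphi(t,\varepsilon)\to(0,0,0)$ as $\varepsilon\to0$.
   Formalization: Under (H3) the periodic solution is only required to be nonzero and may be an equilibrium, since nonconstant ones can fail to exist (ω=h=β=1, k=−ε, α=ε³, μ=ε, ν=0); under (H1), (H2), (H4) it is nonconstant. *)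

theory Defs
  imports "HOL-Analysis.Analysis" "HOL-Computational_Algebra.Polynomial"
begin

definition smooth_near_0 :: "(real \<Rightarrow> real) \<Rightarrow> bool" where
  "smooth_near_0 f \<longleftrightarrow>
     (\<exists>r>0. \<forall>n. \<forall>x\<in>{-r<..<r}. ((deriv ^^ n) f) field_differentiable (at x))"

definition taylor_coeff :: "(real \<Rightarrow> real) \<Rightarrow> nat \<Rightarrow> real" where
  "taylor_coeff f i = (deriv ^^ i) f 0 / fact i"

definition vector_field ::
  "real \<Rightarrow> real \<Rightarrow> real \<Rightarrow> real \<Rightarrow> real \<Rightarrow> real \<Rightarrow> real \<times> real \<times> real \<Rightarrow> real \<times> real \<times> real" where
  "vector_field h k \<alpha> \<beta> \<mu> \<nu> =
     (\<lambda>(x, y, z). (- \<nu> * (x ^ 3 - \<mu> * x - y), - h * z + k * x - \<alpha> * y, \<beta> * y))"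

definition solution :: "('a::real_normed_vector \<Rightarrow> 'a) \<Rightarrow> (real \<Rightarrow> 'a) \<Rightarrow> bool" where
  "solution F \<phi> \<longleftrightarrow> (\<forall>t. (\<phi> has_vector_derivative F (\<phi> t)) (at t))"

definition periodic :: "(real \<Rightarrow> 'a) \<Rightarrow> bool" where
  "periodic \<phi> \<longleftrightarrow> (\<exists>T>0. \<forall>t. \<phi> (t + T) = \<phi> t)"

text \<open>
  In the four hypotheses the divisions and the square root are the real ones: the strict
  inequalities force the denominators \<open>\<nu>\<^sub>0\<close> (H1, H2, H4) and \<open>h\<^sub>0\<close> (H3) to be nonzero, and in H3
  nonnegativity of \<open>\<mu>\<^sub>1\<close> is written out since \<^const>\<open>sqrt\<close> is also defined (and negative)
  at negative arguments.
\<close>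

definition H1 where
  "H1 (\<omega>::real) h k \<alpha> \<beta> \<mu> \<nu> \<longleftrightarrow>
    (let h0 = taylor_coeff h 0; h1 = taylor_coeff h 1; k0 = taylor_coeff k 0;
         \<alpha>0 = taylor_coeff \<alpha> 0; \<alpha>1 = taylor_coeff \<alpha> 1; \<beta>0 = taylor_coeff \<beta> 0;
         \<mu>0 = taylor_coeff \<mu> 0; \<mu>1 = taylor_coeff \<mu> 1;
         \<nu>0 = taylor_coeff \<nu> 0; \<nu>1 = taylor_coeff \<nu> 1;
         \<delta>1 = \<omega>\<^sup>2 * (\<mu>0 * \<nu>1 - \<alpha>1 + \<mu>1 * \<nu>0) - \<beta>0 * h1 * \<mu>0 * \<nu>0
     in h0 = 0 \<and> k0 = - ((\<mu>0\<^sup>2 * \<nu>0\<^sup>2 + \<omega>\<^sup>2) / \<nu>0) \<and> \<alpha>0 = \<mu>0 * \<nu>0 \<and>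
        \<delta>1 * \<nu>0 > 0 \<and> \<beta>0 * h1 * \<mu>0 \<noteq> 0)"

definition H2 where
  "H2 (\<omega>::real) h k \<alpha> \<beta> \<mu> \<nu> \<longleftrightarrow>
    (let h0 = taylor_coeff h 0; k0 = taylor_coeff k 0;
         \<alpha>0 = taylor_coeff \<alpha> 0; \<alpha>1 = taylor_coeff \<alpha> 1;
         \<beta>0 = taylor_coeff \<beta> 0; \<beta>1 = taylor_coeff \<beta> 1;
         \<mu>0 = taylor_coeff \<mu> 0; \<mu>1 = taylor_coeff \<mu> 1;
         \<nu>0 = taylor_coeff \<nu> 0; \<nu>1 = taylor_coeff \<nu> 1;
         \<delta>2 = \<omega>\<^sup>2 * (\<mu>0 * \<nu>1 - \<alpha>1 + \<mu>1 * \<nu>0) - \<beta>1 * h0 * \<mu>0 * \<nu>0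
     in \<beta>0 = 0 \<and> k0 = - ((\<mu>0\<^sup>2 * \<nu>0\<^sup>2 + \<omega>\<^sup>2) / \<nu>0) \<and> \<alpha>0 = \<mu>0 * \<nu>0 \<and>
        \<delta>2 * \<nu>0 > 0 \<and> \<beta>1 * h0 * \<mu>0 \<noteq> 0)"

definition H3 where
  "H3 (\<omega>::real) h k \<alpha> \<beta> \<mu> \<nu> \<longleftrightarrow>
    (let h0 = taylor_coeff h 0; h1 = taylor_coeff h 1;
         k0 = taylor_coeff k 0; k1 = taylor_coeff k 1;
         \<alpha>0 = taylor_coeff \<alpha> 0; \<alpha>1 = taylor_coeff \<alpha> 1;
         \<alpha>2 = taylor_coeff \<alpha> 2; \<alpha>3 = taylor_coeff \<alpha> 3;
         \<beta>0 = taylor_coeff \<beta> 0; \<mu>0 = taylor_coeff \<mu> 0; \<mu>1 = taylor_coeff \<mu> 1;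
         \<nu>0 = taylor_coeff \<nu> 0; \<nu>1 = taylor_coeff \<nu> 1;
         \<delta>3 = sqrt \<mu>1 * (h1 * k0 - h0 * k1) * h0 * \<omega>
     in \<alpha>0 = 0 \<and> \<beta>0 = \<omega>\<^sup>2 / h0 \<and> \<nu>0 = 0 \<and> \<alpha>1 = 0 \<and> \<mu>0 = 0 \<and> \<alpha>2 = 0 \<and>
        \<mu>1 \<ge> 0 \<and> \<delta>3 > 0 \<and> 2 * k0 * \<mu>1 * \<nu>1\<^sup>2 - \<alpha>3 * \<omega>\<^sup>2 \<noteq> 0)"

definition H4 where
  "H4 (\<omega>::real) h k \<alpha> \<beta> \<mu> \<nu> \<longleftrightarrow>
    (let h0 = taylor_coeff h 0; h1 = taylor_coeff h 1; k0 = taylor_coeff k 0;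
         \<alpha>0 = taylor_coeff \<alpha> 0; \<alpha>1 = taylor_coeff \<alpha> 1; \<beta>0 = taylor_coeff \<beta> 0;
         \<mu>0 = taylor_coeff \<mu> 0; \<mu>1 = taylor_coeff \<mu> 1; \<nu>0 = taylor_coeff \<nu> 0;
         \<delta>4 = \<nu>0 * (\<mu>1 * \<nu>0 - \<alpha>1)
     in \<alpha>0 = 0 \<and> k0 = - (\<omega>\<^sup>2 / \<nu>0) \<and> h0 = 0 \<and> \<mu>0 = 0 \<and>
        \<delta>4 > 0 \<and> \<beta>0 * h1 * (2 * \<alpha>1\<^sup>2 - 3 * \<alpha>1 * \<mu>1 * \<nu>0 + \<mu>1\<^sup>2 * \<nu>0\<^sup>2) \<noteq> 0)"

text \<open>
  The origin is itself a constant solution, so a periodic solution has to be asked to be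
  nontrivial. Nonconstancy is the usual reading of that, but H3 does not provide it: the
  following coefficients are smooth and satisfy H3, yet for every \<open>\<epsilon> > 0\<close> all periodic
  solutions of the system are equilibria (\<open>x\<close> is constant and \<open>(y, z)\<close> is a damped linear
  oscillator). What H3 does give is an equilibrium other than the origin that tends to
  the origin.
\<close>

lemma deriv_funpow_poly: "(deriv ^^ n) (poly p) = poly ((pderiv ^^ n) (p :: real poly))"
proof (induction n)
  case (Suc n)
  have "deriv (poly q) = poly (pderiv q)" for q :: "real poly"
    by (rule ext) (rule DERIV_imp_deriv, rule poly_DERIV)
  then show ?case using Suc by simp
qed simp

lemma smooth_near_0_poly: "smooth_near_0 (poly p)"
  unfolding smooth_near_0_def deriv_funpow_poly field_differentiable_def
  using poly_DERIV zero_less_one by blast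

lemma taylor_coeff_poly: "taylor_coeff (poly p) i = coeff p i"
  by (simp add: taylor_coeff_def deriv_funpow_poly poly_0_coeff_0 coeff_higher_pderiv
      pochhammer_fact[symmetric])

lemma H3_without_nonconstant_periodic_solutions:
  fixes h k \<alpha> \<beta> \<mu> \<nu> :: "real poly"
  defines "h \<equiv> [:1:]" and "k \<equiv> [:0, -1:]" and "\<alpha> \<equiv> [:0, 0, 0, 1:]"
    and "\<beta> \<equiv> [:1:]" and "\<mu> \<equiv> [:0, 1:]" and "\<nu> \<equiv> 0"
  shows "H3 1 (poly h) (poly k) (poly \<alpha>) (poly \<beta>) (poly \<mu>) (poly \<nu>)"
    and "\<epsilon> > 0 \<Longrightarrow>
      solution (vector_field (poly h \<epsilon>) (poly k \<epsilon>) (poly \<alpha> \<epsilon>) (poly \<beta> \<epsilon>) (poly \<mu> \<epsilon>) (poly \<nu> \<epsilon>)) \<phi> \<Longrightarrow>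
      periodic \<phi> \<Longrightarrow> \<phi> constant_on UNIV"
proof -
  show "H3 1 (poly h) (poly k) (poly \<alpha>) (poly \<beta>) (poly \<mu>) (poly \<nu>)"
    by (simp add: H3_def taylor_coeff_poly assms coeff_pCons numeral_eq_Suc)
next
  assume e: "\<epsilon> > 0" and per: "periodic \<phi>"
    and sol: "solution (vector_field (poly h \<epsilon>) (poly k \<epsilon>) (poly \<alpha> \<epsilon>) (poly \<beta> \<epsilon>) (poly \<mu> \<epsilon>) (poly \<nu> \<epsilon>)) \<phi>"
  define x y z where "x t = fst (\<phi> t)" and "y t = fst (snd (\<phi> t))"
    and "z t = snd (snd (\<phi> t))" for t
  have phi: "\<phi> t = (x t, y t, z t)" for t by (simp add: x_def y_def z_def)
  have d: "(\<phi> has_vector_derivative (0, - z t - \<epsilon> * x t - \<epsilon> ^ 3 * y t, y t)) (at t)" for t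
  proof -
    have "vector_field (poly h \<epsilon>) (poly k \<epsilon>) (poly \<alpha> \<epsilon>) (poly \<beta> \<epsilon>) (poly \<mu> \<epsilon>) (poly \<nu> \<epsilon>) (\<phi> t)
        = (0, - z t - \<epsilon> * x t - \<epsilon> ^ 3 * y t, y t)"
      by (simp add: phi vector_field_def assms power3_eq_cube)
    then show ?thesis using sol unfolding solution_def by metis
  qed
  note d1 = bounded_linear.has_vector_derivative[OF bounded_linear_fst d]
  note d2 = bounded_linear.has_vector_derivative[OF bounded_linear_snd d]
  have dx: "(x has_real_derivative 0) (at t)" for t
    using d1[of t] unfolding x_def has_real_derivative_iff_has_vector_derivative by simp
  have dy: "(y has_real_derivative - z t - \<epsilon> * x t - \<epsilon> ^ 3 * y t) (at t)" for t
    using bounded_linear.has_vector_derivative[OF bounded_linear_fst d2, of t]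
    unfolding y_def has_real_derivative_iff_has_vector_derivative by simp
  have dz: "(z has_real_derivative y t) (at t)" for t
    using bounded_linear.has_vector_derivative[OF bounded_linear_snd d2, of t]
    unfolding z_def has_real_derivative_iff_has_vector_derivative by simp
  have x: "x t = x 0" for t using DERIV_isconst_all[of x] dx by blast
  define E where "E t = (y t)\<^sup>2 + (z t + \<epsilon> * x t)\<^sup>2" for t
  have dE: "(E has_real_derivative - 2 * \<epsilon> ^ 3 * (y t)\<^sup>2) (at t)" for t
    unfolding E_def
    by (auto intro!: derivative_eq_intros dx dy dz simp: algebra_simps power2_eq_square)
  have mono: "E b \<le> E a" if "a \<le> b" for a b
    by (rule DERIV_nonpos_imp_nonincreasing[OF that]) (use dE e in \<open>force intro: mult_nonneg_nonneg\<close>)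
  obtain T where T: "T > 0" "\<And>t. \<phi> (t + T) = \<phi> t" using per unfolding periodic_def by blast
  have "E (t + T) = E t" for t using T(2)[of t] by (simp add: E_def phi)
  then have E: "E s = E t" if "t \<le> s" "s \<le> t + T" for s t
    using mono[OF that(1)] mono[OF that(2)] by (metis antisym)
  have y0: "y t = 0" for t
  proof -
    have "(E has_real_derivative 0) (at (t + T / 2))" for t
    proof (rule has_field_derivative_transform_within_open[of "\<lambda>_. E t" _ _ "{t<..<t + T}"])
      show "E t = E s" if "s \<in> {t<..<t + T}" for s using E[of t s] that by simp
    qed (use T in auto)
    from this[of "t - T / 2"] have "(E has_real_derivative 0) (at t)" by simp
    from DERIV_unique[OF this dE] e show ?thesis by simp
  qed
  have "z t = z 0" for t using DERIV_isconst_all[of z] dz y0 by metis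
  then show "\<phi> constant_on UNIV"
    unfolding constant_on_def using x y0 phi by metis
qed

end

(* With \<gamma> = h \<beta>, each of H1, H2, H4 gives \<gamma>_0 = 0 and a linear part with eigenvalues \<plusminus>i\<omega>, 0 at
   \<epsilon> = 0. The vector field is odd, so we look for orbits with \<phi>(t + T/2) = - \<phi>(t); on antiperiodic
   functions the zero eigenvalue is invisible and only a Hopf-type resonance at \<plusminus>i\<omega> is left. Write
   x(t) = sqrt a X(t/w) with X = cos + D, where D has no first harmonics, and let J be the
   antiperiodic antiderivative. Eliminating y and z and integrating turns the system into
     X + p w J X + q w^2 J^2 X - s w^3 J^3 X + a \<nu> (w J + \<alpha> w^2 J^2 + \<gamma> w^3 J^3) X^3 = 0,
   p = \<alpha> - \<nu> \<mu>,  q = \<gamma> - \<nu> k - \<alpha> \<mu> \<nu>,  s = \<gamma> \<nu> \<mu>,  where p, s, \<gamma> tend to 0 and q tends to \<omega>^2.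
   Its sine, cosine and remaining harmonics are fixed-point equations for a, w and D that contract
   for small \<epsilon>. The sine equation is linear in a; to first order it reads
   a = 4 \<epsilon> \<delta> / (3 \<omega>^2 \<nu>_0) with
     \<delta> = \<omega>^2 (\<mu>_0 \<nu>_1 - \<alpha>_1 + \<mu>_1 \<nu>_0) - \<gamma>_1 \<mu>_0 \<nu>_0,
   and \<delta> \<nu>_0 > 0 under each of the three hypotheses, so that a > 0.
   Under H3 the equilibrium x = sqrt \<mu>, y = 0, z = k x / h is the required solution. *)
theory Submission
  imports Defs
begin

section \<open>Maps with vanishing strict derivative\<close>

text \<open>The triple product filter puts the tail of the parameter and the neighbourhood of the
  origin into a single eventuality, so no radii occur and estimates are combined by
  \<open>eventually_elim\<close>. The sign of \<open>c\<close> is left free.\<close>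

definition lip_near ::
  "'p filter \<Rightarrow> ('p \<Rightarrow> 'u::real_normed_vector \<Rightarrow> 'v::real_normed_vector) \<Rightarrow> real \<Rightarrow> bool" where
  "lip_near F f c \<longleftrightarrow>
     (\<forall>\<^sub>F (e, u, v) in F \<times>\<^sub>F nhds 0 \<times>\<^sub>F nhds 0. norm (f e u - f e v) \<le> c * norm (u - v))"

definition lip_cont ::
  "'p filter \<Rightarrow> ('p \<Rightarrow> 'u::real_normed_vector \<Rightarrow> 'v::real_normed_vector) \<Rightarrow> 'v \<Rightarrow> bool" where
  "lip_cont F f l \<longleftrightarrow> (\<exists>L. lip_near F f L) \<and> ((\<lambda>e. f e 0) \<longlongrightarrow> l) F"

text \<open>Flatness says that the strict derivative at the origin vanishes in the limit along \<open>F\<close>: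
  it holds for terms with a vanishing coefficient as well as for products of two vanishing factors.\<close>

definition flat ::
  "'p filter \<Rightarrow> ('p \<Rightarrow> 'u::real_normed_vector \<Rightarrow> 'v::real_normed_vector) \<Rightarrow> bool" where
  "flat F f \<longleftrightarrow> (\<forall>c>0. lip_near F f c) \<and> ((\<lambda>e. f e 0) \<longlongrightarrow> 0) F"

text \<open>Passes from one point to a pair of points, the shape in which \<open>lip_near\<close> is
  stated.\<close>

lemma eventually_prod_nhds_both:
  assumes "\<forall>\<^sub>F (e, u) in F \<times>\<^sub>F G. P e u"
  shows "\<forall>\<^sub>F (e, u, v) in F \<times>\<^sub>F G \<times>\<^sub>F G. P e u \<and> P e v"
proof -
  obtain Pf Pg where P: "eventually Pf F" "eventually Pg G" "\<And>x y. Pf x \<Longrightarrow> Pg y \<Longrightarrow> P x y"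
    using assms unfolding eventually_prod_filter by auto
  have "\<forall>\<^sub>F (u, v) in G \<times>\<^sub>F G. Pg u \<and> Pg v"
    unfolding eventually_prod_filter using P(2) by auto
  then show ?thesis
    unfolding eventually_prod_filter[of _ F] using P(1,3)
    by (intro exI[of _ Pf] exI[of _ "\<lambda>(u, v). Pg u \<and> Pg v"]) auto
qed

lemma eventually_prod_diagonal_zero:
  assumes "\<forall>\<^sub>F (e, u, v) in F \<times>\<^sub>F nhds 0 \<times>\<^sub>F nhds 0. P e u v"
  shows "\<forall>\<^sub>F (e, u) in F \<times>\<^sub>F nhds 0. P e u 0"
proof -
  have "filterlim (\<lambda>(e, u). (e, u, 0)) (F \<times>\<^sub>F nhds 0 \<times>\<^sub>F nhds 0) (F \<times>\<^sub>F nhds 0)"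
    unfolding case_prod_unfold
    by (intro filterlim_Pair filterlim_fst filterlim_snd tendsto_const)
  from this[unfolded filterlim_iff, rule_format, OF assms] show ?thesis
    by (simp add: case_prod_unfold)
qed

text \<open>Near the origin \<open>norm (f e u - f e 0)\<close> is at most
  \<open>L * norm u\<close>, so the limit along \<open>u = 0\<close> is already the joint
  limit.\<close>

lemma lip_cont_tendsto:
  fixes f :: "'p \<Rightarrow> 'u::real_normed_vector \<Rightarrow> 'v::real_normed_vector"
  assumes "lip_cont F f l" shows "((\<lambda>(e, u). f e u) \<longlongrightarrow> l) (F \<times>\<^sub>F nhds 0)"
proof -
  obtain L where L: "lip_near F f L" and l: "((\<lambda>e. f e 0) \<longlongrightarrow> l) F"
    using assms unfolding lip_cont_def by blast
  have 1: "((\<lambda>(e, u). f e 0) \<longlongrightarrow> l) (F \<times>\<^sub>F nhds 0)"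
    using filterlim_compose[OF l filterlim_fst] by (simp add: case_prod_unfold)
  have "filterlim snd (nhds (0::'u)) (F \<times>\<^sub>F nhds 0)" by (rule filterlim_snd)
  from tendsto_mult_left[OF tendsto_norm[OF this], of L]
  have 2: "((\<lambda>x. L * norm (snd x :: 'u)) \<longlongrightarrow> 0) (F \<times>\<^sub>F nhds 0)" by simp
  have "((\<lambda>(e, u). f e u - f e 0) \<longlongrightarrow> 0) (F \<times>\<^sub>F nhds 0)"
    by (rule Lim_null_comparison[OF _ 2])
      (use eventually_prod_diagonal_zero[OF L[unfolded lip_near_def]] in \<open>simp add:
          case_prod_unfold\<close>)
  from tendsto_add[OF this 1] show ?thesis by (simp add: case_prod_unfold)
qed

lemma lip_cont_tendsto_compose:
  assumes "lip_cont F f l" "(u \<longlongrightarrow> 0) F" shows "((\<lambda>e. f e (u e)) \<longlongrightarrow> l) F"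
  using filterlim_compose[OF lip_cont_tendsto[OF assms(1)] filterlim_Pair[OF filterlim_ident
      assms(2)]]
  by simp

lemma lip_cont_bound:
  assumes "lip_cont F f l" "norm l < M"
  shows "\<forall>\<^sub>F (e, u, v) in F \<times>\<^sub>F nhds 0 \<times>\<^sub>F nhds 0. norm (f e u) \<le> M \<and> norm (f e v) \<le> M"
proof (rule eventually_prod_nhds_both)
  have "((\<lambda>(e, u). norm (f e u)) \<longlongrightarrow> norm l) (F \<times>\<^sub>F nhds 0)"
    using tendsto_norm[OF lip_cont_tendsto[OF assms(1)]] by (simp add: case_prod_unfold)
  from order_tendstoD(2)[OF this assms(2)]
  show "\<forall>\<^sub>F (e, u) in F \<times>\<^sub>F nhds 0. norm (f e u) \<le> M"
    by (auto elim: eventually_mono)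
qed

section \<open>Rules for sums, pairs, linear maps, products and inverses\<close>

lemma lip_near_mono: "lip_near F f c \<Longrightarrow> c \<le> d \<Longrightarrow> lip_near F f d"
  unfolding lip_near_def
  by (elim eventually_mono) (auto intro: order_trans[OF _ mult_right_mono])

lemma lip_near_add:
  assumes "lip_near F f c" "lip_near F g d"
  shows "lip_near F (\<lambda>e u. f e u + g e u) (c + d)"
  using assms unfolding lip_near_def
proof eventually_elim
  case (elim x)
  then show ?case
    by (auto simp: case_prod_unfold distrib_right intro: order_trans[OF norm_diff_triangle_ineq])
qed

lemma lip_near_Pair:
  assumes "lip_near F f c" "lip_near F g d"
  shows "lip_near F (\<lambda>e u. (f e u, g e u)) (c + d)"
  using assms unfolding lip_near_def
proof eventually_elim
  case (elim x)
  then show ?case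
    by (auto simp: case_prod_unfold distrib_right intro: order_trans[OF norm_Pair_le])
qed

lemma lip_cont_const: "(c \<longlongrightarrow> l) F \<Longrightarrow> lip_cont F (\<lambda>e u. c e) l"
  by (auto simp: lip_cont_def lip_near_def case_prod_unfold intro: exI[of _ 0])

lemma flat_const: "(c \<longlongrightarrow> 0) F \<Longrightarrow> flat F (\<lambda>e u. c e)"
  by (auto simp: flat_def lip_near_def case_prod_unfold)

lemma flat_imp_lip_cont: "flat F f \<Longrightarrow> lip_cont F f 0"
  unfolding flat_def lip_cont_def using zero_less_one by blast

lemma lip_cont_bounded_linear: "bounded_linear g \<Longrightarrow> lip_cont F (\<lambda>e. g) 0"
proof -
  assume g: "bounded_linear g"
  obtain K where K: "\<And>x. norm (g x) \<le> norm x * K" using bounded_linear.bounded[OF g] by blast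
  have "norm (g u - g v) \<le> K * norm (u - v)" for u v
    using K[of "u - v"] by (simp add: linear_simps(2)[OF g] mult.commute)
  then have "lip_near F (\<lambda>e. g) K" unfolding lip_near_def by (simp add: case_prod_unfold)
  then show ?thesis unfolding lip_cont_def using linear_simps(3)[OF g] by auto
qed

lemma lip_cont_add:
  "lip_cont F f l \<Longrightarrow> lip_cont F g m \<Longrightarrow> lip_cont F (\<lambda>e u. f e u + g e u) (l + m)"
  unfolding lip_cont_def using lip_near_add tendsto_add by blast

lemma flat_add:
  assumes "flat F f" "flat F g" shows "flat F (\<lambda>e u. f e u + g e u)"
  unfolding flat_def
proof safe
  fix c :: real assume "c > 0"
  then have "lip_near F f (c / 2)" "lip_near F g (c / 2)" using assms unfolding flat_def by auto
  from lip_near_add[OF this] show "lip_near F (\<lambda>e u. f e u + g e u) c" by simp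
next
  show "((\<lambda>e. f e 0 + g e 0) \<longlongrightarrow> 0) F"
    using tendsto_add[of "\<lambda>e. f e 0" 0 F "\<lambda>e. g e 0" 0] assms unfolding flat_def by simp
qed

lemma lip_near_bounded_linear:
  assumes "bounded_linear h" "\<And>x. norm (h x) \<le> K * norm x" "K \<ge> 0" "lip_near F f c"
  shows "lip_near F (\<lambda>e u. h (f e u)) (K * c)"
  using assms(4) unfolding lip_near_def
proof eventually_elim
  case (elim x)
  obtain e u v where x: "x = (e, u, v)" by (cases x)
  have "norm (h (f e u) - h (f e v)) \<le> K * norm (f e u - f e v)"
    using assms(2)[of "f e u - f e v"] by (simp add: linear_simps(2)[OF assms(1)])
  also have "\<dots> \<le> K * (c * norm (u - v))" using elim assms(3) x by (auto intro: mult_left_mono)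
  finally show ?case by (simp add: x mult.assoc)
qed

lemma lip_cont_linear_compose:
  assumes "bounded_linear h" "lip_cont F f l" shows "lip_cont F (\<lambda>e u. h (f e u)) (h l)"
proof -
  obtain K where K: "K > 0" "\<And>x. norm (h x) \<le> norm x * K"
    using bounded_linear.pos_bounded[OF assms(1)] by blast
  then have "norm (h x) \<le> K * norm x" for x by (simp add: mult.commute)
  then show ?thesis
    using assms(2) lip_near_bounded_linear[OF assms(1), of K F f] K(1)
      bounded_linear.tendsto[OF assms(1), of "\<lambda>e. f e 0" l F] unfolding lip_cont_def by force
qed

lemma flat_linear_compose:
  assumes "bounded_linear h" "flat F f" shows "flat F (\<lambda>e u. h (f e u))"
proof -
  obtain K where K: "K > 0" "\<And>x. norm (h x) \<le> norm x * K"
    using bounded_linear.pos_bounded[OF assms(1)] by blast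
  then have K': "norm (h x) \<le> K * norm x" for x by (simp add: mult.commute)
  show ?thesis unfolding flat_def
  proof safe
    fix c :: real assume "c > 0"
    then have "lip_near F f (c / K)" using assms K(1) unfolding flat_def by simp
    from lip_near_bounded_linear[OF assms(1) K' _ this] show "lip_near F (\<lambda>e u. h (f e u)) c"
      using K(1) by simp
  next
    show "((\<lambda>e. h (f e 0)) \<longlongrightarrow> 0) F"
      using bounded_linear.tendsto[OF assms(1), of "\<lambda>e. f e 0" 0] assms(2) linear_simps(3)[OF
          assms(1)]
      unfolding flat_def by simp
  qed
qed

text \<open>Product rule: the increment splits as
  \<open>b (f e u) (g e u - g e v) + b (f e u - f e v) (g e v)\<close>, and near the origin a factor
  is bounded by any number above the norm of its limit.\<close>

lemma lip_near_bilinear: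
  assumes "bounded_bilinear b" "\<And>x y. norm (b x y) \<le> norm x * norm y * K" "K \<ge> 0"
    and f: "lip_cont F f l" "norm l < M" "lip_near F f c"
    and g: "lip_cont F g m" "norm m < N" "lip_near F g d" and "c \<ge> 0" "d \<ge> 0"
  shows "lip_near F (\<lambda>e u. b (f e u) (g e u)) (K * (M * d + c * N))"
  using lip_cont_bound[OF f(1,2)] lip_cont_bound[OF g(1,2)] f(3) g(3) unfolding lip_near_def
proof eventually_elim
  case (elim x)
  interpret bounded_bilinear b by fact
  obtain e u v where x: "x = (e, u, v)" by (cases x)
  have pos: "M \<ge> 0" "N \<ge> 0" using f(2) g(2) norm_ge_zero[of l] norm_ge_zero[of m] by linarith+
  have "norm (b (f e u) (g e u - g e v)) \<le> norm (f e u) * norm (g e u - g e v) * K" by fact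
  also have "\<dots> \<le> M * (d * norm (u - v)) * K"
    using elim x assms(3) pos \<open>d \<ge> 0\<close> by (intro mult_mono mult_nonneg_nonneg) auto
  finally have 1: "norm (b (f e u) (g e u - g e v)) \<le> M * (d * norm (u - v)) * K" .
  have "norm (b (f e u - f e v) (g e v)) \<le> norm (f e u - f e v) * norm (g e v) * K" by fact
  also have "\<dots> \<le> (c * norm (u - v)) * N * K"
    using elim x assms(3) pos \<open>c \<ge> 0\<close> by (intro mult_mono mult_nonneg_nonneg) auto
  finally have 2: "norm (b (f e u - f e v) (g e v)) \<le> (c * norm (u - v)) * N * K" .
  have "b (f e u) (g e u) - b (f e v) (g e v) = b (f e u) (g e u - g e v) + b (f e u
      - f e v) (g e v)"
    by (simp add: diff_left diff_right)
  then have "norm (b (f e u) (g e u) - b (f e v) (g e v))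
      \<le> M * (d * norm (u - v)) * K + (c * norm (u - v)) * N * K"
    using norm_triangle_mono[OF 1 2] by simp
  then show ?case by (simp add: x algebra_simps)
qed

lemma lip_near_nonneg: "lip_near F f c \<Longrightarrow> lip_near F f \<bar>c\<bar>"
  by (rule lip_near_mono) auto

lemma lip_cont_bilinear:
  assumes "bounded_bilinear b" "lip_cont F f l" "lip_cont F g m"
  shows "lip_cont F (\<lambda>e u. b (f e u) (g e u)) (b l m)"
proof -
  obtain K where K: "K \<ge> 0" "\<And>x y. norm (b x y) \<le> norm x * norm y * K"
    using bounded_bilinear.nonneg_bounded[OF assms(1)] by blast
  obtain c d where "lip_near F f c" "lip_near F g d" using assms unfolding lip_cont_def by blast
  then have "lip_near F (\<lambda>e u. b (f e u) (g e u)) (K * ((norm l + 1) * \<bar>d\<bar> + \<bar>c\<bar> * (norm m + 1)))"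
    using assms K by (intro lip_near_bilinear[of b K F f l _ _ g m] lip_near_nonneg) auto
  moreover have "((\<lambda>e. b (f e 0) (g e 0)) \<longlongrightarrow> b l m) F"
    using assms by (auto simp: lip_cont_def intro: bounded_bilinear.tendsto)
  ultimately show ?thesis unfolding lip_cont_def by blast
qed

text \<open>The product rule has two summands, each a Lipschitz constant of one factor times a bound
  of the other. A summand is arbitrarily small if its Lipschitz constant is, or if the other factor
  has limit zero, since its bound can then be chosen small; \<open>fs\<close> and \<open>gs\<close>
  grant one of the two for each summand.\<close>

lemma flat_bilinear_aux:
  assumes "bounded_bilinear b" "lip_cont F f l" "lip_cont F g m" "b l m = 0"
    and c: "c > 0"
    and fs: "(\<forall>d>0. lip_near F f d) \<or> m = 0" and gs: "(\<forall>d>0. lip_near F g d) \<or> l = 0"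
  shows "lip_near F (\<lambda>e u. b (f e u) (g e u)) c"
proof -
  obtain K0 where K0: "K0 \<ge> 0" "\<And>x y. norm (b x y) \<le> norm x * norm y * K0"
    using bounded_bilinear.nonneg_bounded[OF assms(1)] by blast
  define K where "K = K0 + 1"
  have K: "K > 0" "\<And>x y. norm (b x y) \<le> norm x * norm y * K"
    using K0 by (auto simp: K_def intro!: order_trans[OF K0(2)] mult_left_mono)
  have aux: "K * (x * (c / (2 * K * x))) = c / 2" if "x > 0" for x
    using that K(1) by (simp add: field_simps)
  obtain c0 d0 where c0: "lip_near F f c0" and d0: "lip_near F g d0"
    using assms unfolding lip_cont_def by blast
  have "\<exists>N d'. norm m < N \<and> lip_near F f d' \<and> d' \<ge> 0 \<and> K * (d' * N) \<le> c / 2"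
  proof (cases "m = 0")
    case True
    define N where "N = c / (2 * K * (\<bar>c0\<bar> + 1))"
    have "N > 0" using c K by (auto simp: N_def)
    moreover have "K * (\<bar>c0\<bar> * N) \<le> K * ((\<bar>c0\<bar> + 1) * N)"
      using K(1) \<open>N > 0\<close> by (intro mult_left_mono mult_right_mono) auto
    moreover have "K * ((\<bar>c0\<bar> + 1) * N) = c / 2" unfolding N_def by (intro aux) simp
    ultimately show ?thesis using True lip_near_nonneg[OF c0]
      by (intro exI[of _ N] exI[of _ "\<bar>c0\<bar>"]) auto
  next
    case False
    define d' where "d' = c / (2 * K * (norm m + 1))"
    have "norm m + 1 > 0" by (simp add: add_nonneg_pos)
    then have "d' > 0" "K * (d' * (norm m + 1)) = c / 2"
      using c K(1) aux[of "norm m + 1"] unfolding d'_def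
      by (auto simp del: distrib_left simp: mult.commute[of "_ / _"])
    then show ?thesis using False fs by (intro exI[of _ "norm m + 1"] exI[of _ d']) auto
  qed
  then obtain N d' where N: "norm m < N" "lip_near F f d'" "d' \<ge> 0" "K * (d' * N) \<le> c / 2" by blast
  have "\<exists>M d'. norm l < M \<and> lip_near F g d' \<and> d' \<ge> 0 \<and> K * (M * d') \<le> c / 2"
  proof (cases "l = 0")
    case True
    define M where "M = c / (2 * K * (\<bar>d0\<bar> + 1))"
    have "M > 0" using c K by (auto simp: M_def)
    moreover have "K * (M * \<bar>d0\<bar>) \<le> K * (M * (\<bar>d0\<bar> + 1))"
      using K(1) \<open>M > 0\<close> by (intro mult_left_mono) auto
    moreover have "K * (M * (\<bar>d0\<bar> + 1)) = c / 2"
      unfolding M_def mult.commute[of "c / _"] by (intro aux) simp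
    ultimately show ?thesis using True lip_near_nonneg[OF d0]
      by (intro exI[of _ M] exI[of _ "\<bar>d0\<bar>"]) auto
  next
    case False
    define d' where "d' = c / (2 * K * (norm l + 1))"
    have "norm l + 1 > 0" by (simp add: add_nonneg_pos)
    then have "d' > 0" "K * ((norm l + 1) * d') = c / 2"
      using c K(1) aux[of "norm l + 1"] unfolding d'_def by auto
    then show ?thesis using False gs by (intro exI[of _ "norm l + 1"] exI[of _ d']) auto
  qed
  then obtain M d'' where M: "norm l < M" "lip_near F g d''" "d'' \<ge> 0" "K * (M * d'') \<le> c / 2"
      by blast
  have "lip_near F (\<lambda>e u. b (f e u) (g e u)) (K * (M * d'' + d' * N))"
    using assms K N M by (intro lip_near_bilinear[of b K F f l M d' g m N d'']) auto
  then show ?thesis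
    by (rule lip_near_mono) (use N M in \<open>simp add: distrib_left\<close>)
qed

lemma flat_bilinear:
  assumes "bounded_bilinear b" "lip_cont F f l" "lip_cont F g m" "b l m = 0"
    and "(\<forall>d>0. lip_near F f d) \<or> m = 0" "(\<forall>d>0. lip_near F g d) \<or> l = 0"
  shows "flat F (\<lambda>e u. b (f e u) (g e u))"
  unfolding flat_def
proof (intro conjI allI impI)
  show "lip_near F (\<lambda>e u. b (f e u) (g e u)) c" if "c > 0" for c
    using flat_bilinear_aux[OF assms(1-4) that assms(5-6)] .
  show "((\<lambda>e. b (f e 0) (g e 0)) \<longlongrightarrow> 0) F"
    using lip_cont_bilinear[OF assms(1-3)] assms(4) by (simp add: lip_cont_def)
qed

lemma flat_bilinear_left:
  assumes "bounded_bilinear b" "flat F f" "lip_cont F g m"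
  shows "flat F (\<lambda>e u. b (f e u) (g e u))"
  by (rule flat_bilinear[OF assms(1) flat_imp_lip_cont[OF assms(2)] assms(3)])
    (use assms in \<open>auto simp: flat_def bounded_bilinear.zero_left\<close>)

text \<open>Also covers factors that are not flat themselves, such as \<open>fst u * fst u\<close>:
  each Lipschitz constant is multiplied by a bound of the other factor, and that bound can be made
  small.\<close>

lemma flat_bilinear_vanishing:
  assumes "bounded_bilinear b" "lip_cont F f 0" "lip_cont F g 0"
  shows "flat F (\<lambda>e u. b (f e u) (g e u))"
  by (rule flat_bilinear[OF assms])
    (use assms in \<open>auto simp: bounded_bilinear.zero_left\<close>)

text \<open>Near the origin both values exceed \<open>\<bar>l\<bar> / 2\<close> in modulus, so the
  difference of the inverses costs at most the factor \<open>4 / l\<^sup>2\<close>.\<close>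

lemma lip_cont_inverse:
  fixes f :: "'p \<Rightarrow> 'u::real_normed_vector \<Rightarrow> real"
  assumes "lip_cont F f l" "l \<noteq> 0"
  shows "lip_cont F (\<lambda>e u. inverse (f e u)) (inverse l)"
proof -
  obtain c where c: "lip_near F f c" using assms unfolding lip_cont_def by blast
  have "((\<lambda>(e, u). \<bar>f e u\<bar>) \<longlongrightarrow> \<bar>l\<bar>) (F \<times>\<^sub>F nhds 0)"
    using tendsto_rabs[OF lip_cont_tendsto[OF assms(1)]] by (simp add: case_prod_unfold)
  from order_tendstoD(1)[OF this, of "\<bar>l\<bar> / 2"] assms(2)
  have "\<forall>\<^sub>F (e, u) in F \<times>\<^sub>F nhds 0. \<bar>f e u\<bar> > \<bar>l\<bar> / 2" by (simp add: case_prod_unfold)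
  from eventually_prod_nhds_both[OF this] c
  have "lip_near F (\<lambda>e u. inverse (f e u)) (\<bar>c\<bar> * 4 / l\<^sup>2)"
    unfolding lip_near_def
  proof eventually_elim
    case (elim x)
    obtain e u v where x: "x = (e, u, v)" by (cases x)
    from elim x have 1: "\<bar>f e u\<bar> > \<bar>l\<bar> / 2" "\<bar>f e v\<bar> > \<bar>l\<bar> / 2"
      and 2: "\<bar>f e u - f e v\<bar> \<le> c * norm (u - v)" by auto
    have nz: "f e u \<noteq> 0" "f e v \<noteq> 0" using 1 by auto
    have "l\<^sup>2 / 4 = (\<bar>l\<bar> / 2) * (\<bar>l\<bar> / 2)" by (simp add: power2_eq_square)
    also have "\<dots> \<le> \<bar>f e u\<bar> * \<bar>f e v\<bar>" using 1 by (intro mult_mono) auto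
    finally have 3: "l\<^sup>2 / 4 \<le> \<bar>f e u\<bar> * \<bar>f e v\<bar>" .
    have "inverse (f e u) - inverse (f e v) = - ((f e u - f e v) / (f e u * f e v))"
      using nz by (simp add: field_simps)
    then have "\<bar>inverse (f e u) - inverse (f e v)\<bar> = \<bar>f e u - f e v\<bar> / (\<bar>f e u\<bar> * \<bar>f e v\<bar>)"
      by (simp add: abs_mult)
    also have "\<dots> \<le> (\<bar>c\<bar> * norm (u - v)) / (l\<^sup>2 / 4)"
      using 3 assms(2) by (intro frac_le order_trans[OF 2] mult_right_mono) auto
    finally show ?case by (simp add: x mult_ac)
  qed
  moreover have "((\<lambda>e. inverse (f e 0)) \<longlongrightarrow> inverse l) F"
    using assms unfolding lip_cont_def by (auto intro: tendsto_inverse)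
  ultimately show ?thesis unfolding lip_cont_def by blast
qed

text \<open>Banach's theorem on the part of \<open>S\<close> in a ball of fixed radius
  \<open>r\<close>. This part is mapped into itself once \<open>norm (N e 0) < (1 - c) * r\<close>,
  and the fixed point has norm at most \<open>norm (N e 0) / (1 - c)\<close>, so it tends to zero.
  The set \<open>S\<close> will carry antiperiodicity.\<close>

lemma small_fixed_point:
  fixes N :: "'p \<Rightarrow> 'u \<Rightarrow> 'u::{real_normed_vector, complete_space}"
  assumes "lip_near F N c" "0 \<le> c" "c < 1" "((\<lambda>e. N e 0) \<longlongrightarrow> 0) F"
    and S: "closed S" "0 \<in> S" "\<forall>\<^sub>F e in F. \<forall>u\<in>S. N e u \<in> S"
  shows "\<exists>u. (u \<longlongrightarrow> 0) F \<and> (\<forall>\<^sub>F e in F. u e \<in> S \<and> N e (u e) = u e)"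
proof -
  have "\<exists>Q R. eventually Q F \<and> eventually R (nhds (0::'u)) \<and>
      (\<forall>e u v. Q e \<longrightarrow> R u \<longrightarrow> R v \<longrightarrow> norm (N e u - N e v) \<le> c * norm (u - v))"
  proof -
    obtain Q R' where Q: "eventually Q F" "eventually R' (nhds (0::'u) \<times>\<^sub>F nhds 0)"
      "\<And>e p. Q e \<Longrightarrow> R' p \<Longrightarrow> norm (N e (fst p) - N e (snd p)) \<le> c * norm (fst p - snd p)"
      using assms(1) unfolding lip_near_def eventually_prod_filter[of _ F] by auto
    obtain R1 R2 where "eventually R1 (nhds (0::'u))" "eventually R2 (nhds (0::'u))"
      "\<And>u v. R1 u \<Longrightarrow> R2 v \<Longrightarrow> R' (u, v)"
      using Q(2) unfolding eventually_prod_filter by auto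
    note R12 = this
    have "eventually (\<lambda>u. R1 u \<and> R2 u) (nhds 0)" using R12(1,2) by (rule eventually_conj)
    moreover have "norm (N e u - N e v) \<le> c * norm (u - v)"
      if "Q e" "R1 u \<and> R2 u" "R1 v \<and> R2 v" for e u v
      using Q(3)[OF that(1) R12(3)[of u v]] that by simp
    ultimately show ?thesis using Q(1) by blast
  qed
  then obtain Q R where Q: "eventually Q F" and R: "eventually R (nhds (0::'u))"
    and QR: "\<And>e u v. Q e \<Longrightarrow> R u \<Longrightarrow> R v \<Longrightarrow> norm (N e u - N e v) \<le> c * norm (u - v)" by blast
  from R obtain r0 where "r0 > 0" "\<And>u. dist u 0 < r0 \<Longrightarrow> R u"
    unfolding eventually_nhds_metric by blast
  \<comment> \<open>Half of \<open>r0\<close>, so that the closed ball stays within the open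
    one.\<close>
  define r where "r = r0 / 2"
  have r: "r > 0" "\<And>u. norm u \<le> r \<Longrightarrow> R u"
    using \<open>r0 > 0\<close> \<open>\<And>u. dist u 0 < r0 \<Longrightarrow> R u\<close> by (auto simp: r_def)
  have "(1 - c) * r > 0" using r assms by simp
  then have ev0: "\<forall>\<^sub>F e in F. norm (N e 0) < (1 - c) * r"
    using order_tendstoD(2)[OF tendsto_norm_zero[OF assms(4)]] by blast
  \<comment> \<open>The norm bound is part of the predicate so that it survives the choice of one
    fixed point for each parameter.\<close>
  define fixes_at where "fixes_at e u \<longleftrightarrow> u \<in> S \<and> norm u \<le> norm (N e 0) / (1 - c) \<and> N e u = u" for e u
  have ex: "\<forall>\<^sub>F e in F. \<exists>u. fixes_at e u"
    using ev0 Q S(3)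
  proof eventually_elim
    case (elim e)
    have lip: "norm (N e u - N e v) \<le> c * norm (u - v)" if "norm u \<le> r" "norm v \<le> r" for u v
      using QR[OF elim(2)] r(2) that by blast
    have le: "norm (N e u) \<le> c * norm u + norm (N e 0)" if "norm u \<le> r" for u
      using lip[OF that, of 0] r(1) norm_triangle_ineq4[of "N e u - N e 0" "- N e 0"] by simp
    have "\<exists>!u. u \<in> S \<inter> cball 0 r \<and> N e u = u"
    proof (rule Banach_fix[OF _ _ assms(2,3)])
      show "complete (S \<inter> cball 0 r)" using S(1) by (simp add: complete_eq_closed closed_Int)
      show "S \<inter> cball 0 r \<noteq> {}" using S(2) r(1) by force
      show "N e ` (S \<inter> cball 0 r) \<subseteq> S \<inter> cball 0 r"
      proof (intro image_subsetI IntI)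
        fix u assume "u \<in> S \<inter> cball 0 r"
        then have u: "u \<in> S" "u \<in> cball 0 r" by auto
        then show "N e u \<in> S" using elim(3) by blast
        have "c * norm u \<le> c * r" using u assms(2) by (auto intro: mult_left_mono)
        then show "N e u \<in> cball 0 r" using le[of u] u elim(1) by (simp add: algebra_simps)
      qed
      show "dist (N e u) (N e v) \<le> c * dist u v" if "u \<in> S \<inter> cball 0 r" "v \<in> S \<inter> cball 0 r" for u v
        using lip that by (simp add: dist_norm)
    qed
    then obtain u where u: "u \<in> S" "norm u \<le> r" "N e u = u" by auto
    have "norm u \<le> norm (N e 0) / (1 - c)"
      using le[OF u(2)] u(3) assms(3) by (simp add: field_simps)
    then show ?case using u unfolding fixes_at_def by blast
  qed
  define u where "u e = (SOME u. fixes_at e u)" for e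
  have u: "\<forall>\<^sub>F e in F. fixes_at e (u e)"
    using ex by eventually_elim (auto simp: u_def intro: someI)
  have "((\<lambda>e. norm (N e 0) / (1 - c)) \<longlongrightarrow> 0) F"
    using tendsto_divide[OF tendsto_norm_zero[OF assms(4)] tendsto_const[of "1 - c"]] assms(3)
        by simp
  then have "(u \<longlongrightarrow> 0) F"
    by (rule Lim_null_comparison[rotated]) (use u in \<open>auto simp: fixes_at_def elim:
        eventually_mono\<close>)
  then show ?thesis using u by (auto simp: fixes_at_def elim: eventually_mono)
qed

section \<open>Antiperiodic functions\<close>

abbreviation antiperiodic :: "(real \<Rightarrow> real) \<Rightarrow> bool" where
  "antiperiodic u \<equiv> (\<forall>t. u (t + pi) = - u t)"

text \<open>Both \<open>J\<close> and the operator with kernel \<open>res_kernel\<close> have this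
  form, so continuity and boundedness are proved once for continuous kernels.\<close>

definition half_conv :: "(real \<Rightarrow> real) \<Rightarrow> (real \<Rightarrow> real) \<Rightarrow> real \<Rightarrow> real" where
  "half_conv \<kappa> u t = integral {0..pi} (\<lambda>s. \<kappa> s * u (t - s))"

text \<open>Half a period suffices: for antiperiodic \<open>u\<close> the product with
  \<open>cos\<close> has period \<open>pi\<close>, so this is the usual first Fourier
  coefficient.\<close>

definition fourier_cos :: "(real \<Rightarrow> real) \<Rightarrow> real" where
  "fourier_cos u = 2 / pi * integral {0..pi} (\<lambda>s. u s * cos s)"

definition fourier_sin :: "(real \<Rightarrow> real) \<Rightarrow> real" where
  "fourier_sin u = 2 / pi * integral {0..pi} (\<lambda>s. u s * sin s)"

text \<open>For antiperiodic \<open>u\<close> this is half the integral of \<open>u\<close> over \<open>[t - \<pi>, t]\<close>, the only antiperiodic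
  antiderivative of \<open>u\<close>.\<close>

definition antideriv :: "(real \<Rightarrow> real) \<Rightarrow> real \<Rightarrow> real" where
  "antideriv = half_conv (\<lambda>_. 1 / 2)"

section \<open>Antiderivatives and first harmonics of antiperiodic functions\<close>

lemma has_antiderivative:
  fixes u :: "real \<Rightarrow> real"
  assumes "continuous_on UNIV u"
  obtains U where "\<And>t. (U has_real_derivative u t) (at t)"
  using einterval_antiderivative[of "-\<infinity>" "\<infinity>" u] assms
  by (auto simp: continuous_on_eq_continuous_at has_real_derivative_iff_has_vector_derivative)

lemma integral_eq_diff:
  fixes f F :: "real \<Rightarrow> real"
  assumes "a \<le> b" "\<And>t. (F has_real_derivative f t) (at t)"
  shows "integral {a..b} f = F b - F a"
  by (intro integral_unique fundamental_theorem_of_calculus assms)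
    (auto simp: has_real_derivative_iff_has_vector_derivative[symmetric] intro:
        has_field_derivative_at_within assms)

lemma antiperiodic_minus: "antiperiodic u \<Longrightarrow> u (t - pi) = - u t"
  by (metis add.commute add_diff_cancel_left' diff_add_cancel minus_minus)

lemma half_conv_antiperiodic: "antiperiodic u \<Longrightarrow> antiperiodic (half_conv \<kappa> u)"
proof
  fix t assume u: "antiperiodic u"
  have "(\<lambda>s. \<kappa> s * u (t + pi - s)) = (\<lambda>s. - (\<kappa> s * u (t - s)))"
  proof
    fix s show "\<kappa> s * u (t + pi - s) = - (\<kappa> s * u (t - s))"
      using u[rule_format, of "t - s"] by (simp add: algebra_simps)
  qed
  then show "half_conv \<kappa> u (t + pi) = - half_conv \<kappa> u t"
    unfolding half_conv_def by simp
qed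

lemma antideriv_antiperiodic: "antiperiodic u \<Longrightarrow> antiperiodic (antideriv u)"
  unfolding antideriv_def by (rule half_conv_antiperiodic)

lemma antideriv_eq:
  assumes "\<And>t. (U has_real_derivative u t) (at t)"
  shows "antideriv u t = (U t - U (t - pi)) / 2"
proof -
  have "((\<lambda>s. - U (t - s) / 2) has_real_derivative (1 / 2) * u (t - s)) (at s)" for s
    by (auto intro!: derivative_eq_intros DERIV_chain'[OF _ assms])
  from integral_eq_diff[OF pi_ge_zero this] show ?thesis
    by (simp add: antideriv_def half_conv_def field_simps)
qed

lemma DERIV_antideriv:
  assumes "continuous_on UNIV u" "antiperiodic u"
  shows "(antideriv u has_real_derivative u t) (at t)"
proof -
  obtain U where U: "\<And>t. (U has_real_derivative u t) (at t)" using has_antiderivative[OF assms(1)]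
      by blast
  have "((\<lambda>t. (U t - U (t - pi)) / 2) has_real_derivative u t) (at t)"
    by (auto intro!: derivative_eq_intros DERIV_chain'[OF _ U] U simp: antiperiodic_minus[OF
        assms(2)])
  then show ?thesis using antideriv_eq[OF U] by presburger
qed

text \<open>Inserting \<open>U (t - pi) = - U t\<close> in \<open>antideriv_eq\<close> leaves
  \<open>U\<close>; any antiperiodic primitive thus evaluates \<open>antideriv\<close>.\<close>

lemma antideriv_unique:
  assumes "\<And>t. (U has_real_derivative u t) (at t)" "antiperiodic U"
  shows "antideriv u = U"
  by (rule ext) (simp add: antideriv_eq[OF assms(1)] antiperiodic_minus[OF assms(2)])

lemma antideriv_cos: "antideriv cos = sin"
  by (rule antideriv_unique) (auto intro!: derivative_eq_intros)

lemma antideriv_sin: "antideriv sin = (\<lambda>t. - cos t)"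
  by (rule antideriv_unique) (auto intro!: derivative_eq_intros)

lemma continuous_antideriv:
  assumes "continuous_on UNIV u" "antiperiodic u" shows "continuous_on UNIV (antideriv u)"
  using DERIV_antideriv[OF assms] DERIV_isCont continuous_at_imp_continuous_on by blast

text \<open>Integration by parts with \<open>antideriv u * sin\<close>, which vanishes at
  \<open>0\<close> and \<open>pi\<close>. Together with the sine counterpart this says that
  \<open>J\<close> acts on the first harmonics as a quarter turn.\<close>

lemma fourier_cos_antideriv:
  assumes "continuous_on UNIV u" "antiperiodic u"
  shows "fourier_cos (antideriv u) = - fourier_sin u"
proof -
  note D = DERIV_antideriv[OF assms]
  have "integral {0..pi} (\<lambda>s. antideriv u s * cos s + u s * sin s) = 0"
    by (subst integral_eq_diff[of _ _ "\<lambda>s. antideriv u s * sin s"])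
        (auto intro!: derivative_eq_intros D)
  moreover have "integral {0..pi} (\<lambda>s. antideriv u s * cos s + u s * sin s)
      = integral {0..pi} (\<lambda>s. antideriv u s * cos s) + integral {0..pi} (\<lambda>s. u s * sin s)"
    using continuous_antideriv[OF assms] assms(1)
    by (intro integral_add integrable_continuous_real continuous_intros; blast intro:
        continuous_on_subset)
  ultimately have "integral {0..pi} (\<lambda>s. antideriv u s * cos s)
      = - integral {0..pi} (\<lambda>s. u s * sin s)"
    by linarith
  then show ?thesis unfolding fourier_cos_def fourier_sin_def by simp
qed

text \<open>Integration by parts with \<open>antideriv u * cos\<close>; the boundary terms cancel by
  antiperiodicity.\<close>

lemma fourier_sin_antideriv:
  assumes "continuous_on UNIV u" "antiperiodic u"
  shows "fourier_sin (antideriv u) = fourier_cos u"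
proof -
  note D = DERIV_antideriv[OF assms]
  have "integral {0..pi} (\<lambda>s. u s * cos s - antideriv u s * sin s)
      = antideriv u pi * cos pi - antideriv u 0 * cos 0"
    by (rule integral_eq_diff) (auto intro!: derivative_eq_intros D)
  also have "\<dots> = 0" using antideriv_antiperiodic[OF assms(2)]
      by (metis add_0 cos_pi cos_zero minus_mult_minus mult_1_right mult_minus1_right
          right_minus_eq)
  finally have "integral {0..pi} (\<lambda>s. u s * cos s - antideriv u s * sin s) = 0" .
  moreover have "integral {0..pi} (\<lambda>s. u s * cos s - antideriv u s * sin s)
      = integral {0..pi} (\<lambda>s. u s * cos s) - integral {0..pi} (\<lambda>s. antideriv u s * sin s)"
    using continuous_antideriv[OF assms] assms(1)
    by (intro integral_diff integrable_continuous_real continuous_intros; blast intro: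
        continuous_on_subset)
  ultimately have "integral {0..pi} (\<lambda>s. antideriv u s * sin s)
      = integral {0..pi} (\<lambda>s. u s * cos s)"
    by linarith
  then show ?thesis unfolding fourier_cos_def fourier_sin_def by simp
qed

lemma fourier_cos_cos: "fourier_cos cos = 1" and fourier_sin_cos: "fourier_sin cos = 0"
  and fourier_cos_sin: "fourier_cos sin = 0" and fourier_sin_sin: "fourier_sin sin = 1"
proof -
  have cs: "cos t * cos t = 1 - sin t * sin t" for t :: real
    by (metis cos_squared_eq power2_eq_square)
  have "integral {0..pi} (\<lambda>s. cos s * cos s) = pi / 2"
    by (subst integral_eq_diff[of _ _ "\<lambda>s. s / 2 + sin s * cos s / 2"])
      (auto intro!: derivative_eq_intros simp: cs field_simps)
  then show "fourier_cos cos = 1" by (simp add: fourier_cos_def)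
  have "integral {0..pi} (\<lambda>s. sin s * sin s) = pi / 2"
    by (subst integral_eq_diff[of _ _ "\<lambda>s. s / 2 - sin s * cos s / 2"])
      (auto intro!: derivative_eq_intros simp: cs field_simps)
  then show "fourier_sin sin = 1" by (simp add: fourier_sin_def)
  have *: "integral {0..pi} (\<lambda>s. sin s * cos s) = 0"
    by (subst integral_eq_diff[of _ _ "\<lambda>s. sin s * sin s / 2"])
      (auto intro!: derivative_eq_intros simp: field_simps)
  show "fourier_sin cos = 0" "fourier_cos sin = 0"
    using * by (simp_all add: fourier_sin_def fourier_cos_def mult.commute)
qed

text \<open>These are the coefficients in
  \<open>cos t ^ 3 = 3 / 4 * cos t + 1 / 4 * cos (3 * t)\<close>; an explicit primitive gives each
  integral.\<close>

lemma fourier_cos_cos_cubed: "fourier_cos (\<lambda>t. cos t ^ 3) = 3 / 4"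
  and fourier_sin_cos_cubed: "fourier_sin (\<lambda>t. cos t ^ 3) = 0"
proof -
  have s: "sin t ^ 2 = 1 - cos t ^ 2" for t :: real by (simp add: sin_squared_eq)
  have "integral {0..pi} (\<lambda>s. cos s ^ 3 * cos s) = 3 * pi / 8"
  proof (subst integral_eq_diff)
    fix t :: real
    have "((\<lambda>s. 3 * s / 8 + 3 / 8 * (sin s * cos s) + sin s * cos s ^ 3 / 4) has_real_derivative
      3 / 8 + 3 / 8 * (cos t ^ 2 - sin t ^ 2) + (cos t ^ 4 - 3 * sin t ^ 2 * cos t ^ 2) / 4) (at t)"
      by (auto intro!: derivative_eq_intros simp: field_simps power2_eq_square power4_eq_xxxx
          power3_eq_cube)
    also have "3 / 8 + 3 / 8 * (cos t ^ 2 - sin t ^ 2) + (cos t ^ 4 - 3 * sin t ^ 2 * cos t ^ 2) / 4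
        = cos t ^ 3 * cos t"
      unfolding s by (simp add: field_simps power2_eq_square power4_eq_xxxx power3_eq_cube)
    finally show "((\<lambda>s. 3 * s / 8 + 3 / 8 * (sin s * cos s) + sin s * cos s ^ 3 / 4)
        has_real_derivative
      cos t ^ 3 * cos t) (at t)" .
  qed auto
  then show "fourier_cos (\<lambda>t. cos t ^ 3) = 3 / 4" unfolding fourier_cos_def by (simp only:) simp
  have "integral {0..pi} (\<lambda>s. cos s ^ 3 * sin s) = 0"
    by (subst integral_eq_diff[of _ _ "\<lambda>s. - (cos s ^ 4) / 4"])
      (auto intro!: derivative_eq_intros)
  then show "fourier_sin (\<lambda>t. cos t ^ 3) = 0" by (simp add: fourier_sin_def)
qed

text \<open>The kernel of \<open>J\<^sup>2 + P\<close>, where \<open>P\<close> projects onto the first harmonics. As \<open>J\<^sup>2\<close> is \<open>- 1\<close>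
  there, only the harmonics of order at least three survive, which makes the operator a contraction.\<close>

definition res_kernel :: "real \<Rightarrow> real" where
  "res_kernel s = s / 2 - pi / 4 + 2 / pi * cos s"

text \<open>By parts, the linear part of the kernel yields \<open>J\<close> applied twice, the
  boundary terms cancelling by antiperiodicity. The cosine part yields the projection, by the
  addition theorem for \<open>s = t - (t - s)\<close>.\<close>

lemma half_conv_res_kernel:
  assumes u: "continuous_on UNIV u" "antiperiodic u"
  shows "half_conv res_kernel u t = antideriv (antideriv u) t + (fourier_cos u * cos t
      + fourier_sin u * sin t)"
proof -
  note D = DERIV_antideriv[OF u]
  note D2 = DERIV_antideriv[OF continuous_antideriv[OF u] antideriv_antiperiodic[OF u(2)]]
  note ap = antiperiodic_minus[OF antideriv_antiperiodic[OF u(2)]]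
    antiperiodic_minus[OF antideriv_antiperiodic[OF antideriv_antiperiodic[OF u(2)]]]
  obtain C where C: "\<And>t. (C has_real_derivative u t * cos t) (at t)"
    using has_antiderivative[OF continuous_on_mult[OF u(1) continuous_on_cos[OF
        continuous_on_id]]] by blast
  obtain S where S: "\<And>t. (S has_real_derivative u t * sin t) (at t)"
    using has_antiderivative[OF continuous_on_mult[OF u(1) continuous_on_sin[OF
        continuous_on_id]]] by blast
  \<comment> \<open>The integrand \<open>u t * cos t\<close> has period \<open>pi\<close>, so its
    integral over any window of length \<open>pi\<close> is the one that defines
    \<open>fourier_cos\<close>; likewise for the sine.\<close>
  have "((\<lambda>t. C t - C (t - pi)) has_real_derivative 0) (at t)" for t
    by (auto intro!: derivative_eq_intros DERIV_chain'[OF _ C] C simp: antiperiodic_minus[OF u(2)])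
  then have C': "C t - C (t - pi) = C pi - C (pi - pi)"
    using DERIV_isconst_all[of "\<lambda>t. C t - C (t - pi)"] by blast
  have "((\<lambda>t. S t - S (t - pi)) has_real_derivative 0) (at t)" for t
    by (auto intro!: derivative_eq_intros DERIV_chain'[OF _ S] S simp: antiperiodic_minus[OF u(2)])
  then have S': "S t - S (t - pi) = S pi - S (pi - pi)"
    using DERIV_isconst_all[of "\<lambda>t. S t - S (t - pi)"] by blast
  have a: "2 / pi * (C t - C (t - pi)) = fourier_cos u" "2 / pi * (S t - S (t - pi))
      = fourier_sin u"
    unfolding fourier_cos_def fourier_sin_def C' S' integral_eq_diff[OF pi_ge_zero C]
      integral_eq_diff[OF pi_ge_zero S] by simp_all
  have "half_conv res_kernel u t =
      (- (pi / 2 - pi / 4) * antideriv u (t - pi) - antideriv (antideriv u) (t - pi) / 2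
         - 2 / pi * (cos t * C (t - pi) + sin t * S (t - pi)))
      - (pi / 4 * antideriv u t - antideriv (antideriv u) t / 2 - 2 / pi * (cos t * C t
          + sin t * S t))"
  proof -
    have "((\<lambda>s. - (s / 2 - pi / 4) * antideriv u (t - s) - antideriv (antideriv u) (t - s) / 2
         - 2 / pi * (cos t * C (t - s) + sin t * S (t - s))) has_real_derivative
         res_kernel s * u (t - s)) (at s)" for s
    proof -
      have "cos t * cos (t - s) + sin t * sin (t - s) = cos s"
        using cos_diff[of t "t - s"] by simp
      then have c: "cos s = cos t * cos (t - s) + sin t * sin (t - s)" by simp
      have e: "res_kernel s * u (t - s) = (s / 2 - pi / 4) * u (t - s) + 2 / pi *
        (cos t * (u (t - s) * cos (t - s)) + sin t * (u (t - s) * sin (t - s)))"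
        unfolding res_kernel_def c by (simp add: field_simps)
      show ?thesis unfolding e
        by (auto intro!: derivative_eq_intros DERIV_chain'[OF _ C] DERIV_chain'[OF _ S]
            DERIV_chain'[OF _ D]
          DERIV_chain'[OF _ D2] simp: field_simps)
    qed
    from integral_eq_diff[OF pi_ge_zero this] show ?thesis unfolding half_conv_def by simp
  qed
  also have "\<dots> = antideriv (antideriv u) t
      + (2 / pi * (C t - C (t - pi)) * cos t + 2 / pi * (S t - S (t - pi)) * sin t)"
    unfolding ap by (simp add: algebra_simps)
  finally show ?thesis unfolding a .
qed

lemma cos_ge_one_minus_square: "1 - x\<^sup>2 / 2 \<le> cos x" for x :: real
proof -
  have "(sin (x / 2))\<^sup>2 \<le> (x / 2)\<^sup>2" using abs_sin_x_le_abs_x[of "x / 2"] by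
      (simp only: abs_le_square_iff)
  then show ?thesis using cos_double_sin[of "x / 2"] by (simp add: power_divide)
qed

text \<open>About the midpoint \<open>pi / 2\<close> the kernel is the odd function
  \<open>g\<close>, so the range from \<open>0\<close> to \<open>pi / 2\<close> suffices. There
  \<open>sin x \<le> x\<close> bounds \<open>g\<close> from above, and
  \<open>cos_ge_one_minus_square\<close> at \<open>pi / 2 - x\<close> bounds it from below.
  Multiplied by the length \<open>pi\<close> of the interval, the bound stays below one.\<close>

lemma res_kernel_bound:
  assumes "s \<in> {0..pi}" shows "\<bar>res_kernel s\<bar> \<le> 1 - pi / 4"
proof -
  define g where "g x = 2 / pi * sin x - x / 2" for x :: real
  have pi: "3.14 < pi" "pi < 3.15" using pi_approx by simp_all
  have bound: "\<bar>g x\<bar> \<le> 1 - pi / 4" if x: "0 \<le> x" "x \<le> pi / 2" for x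
  proof -
    have "sin x \<le> x" using x by (simp add: sin_x_le_x)
    then have "2 / pi * sin x \<le> 2 / pi * x" using pi by (intro mult_left_mono) auto
    then have "g x \<le> (2 / pi - 1 / 2) * x" by (simp add: g_def algebra_simps)
    also have "\<dots> \<le> (2 / pi - 1 / 2) * (pi / 2)" using x pi by (intro mult_left_mono)
        (auto simp: field_simps)
    also have "\<dots> = 1 - pi / 4" using pi by (simp add: field_simps)
    finally have 1: "g x \<le> 1 - pi / 4" .
    have "2 / pi * (1 - (pi / 2 - x)\<^sup>2 / 2) \<le> 2 / pi * sin x"
      using cos_ge_one_minus_square[of "pi / 2 - x"] pi by (intro mult_left_mono)
          (auto simp: cos_diff)
    also have "2 / pi * (1 - (pi / 2 - x)\<^sup>2 / 2) = 2 / pi + (pi / 2 - x) * x / pi - pi / 4 + x / 2"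
      using pi by (simp add: field_simps power2_eq_square)
    finally have "2 / pi + (pi / 2 - x) * x / pi - pi / 4 \<le> g x" by (simp add: g_def)
    moreover have "(pi / 2 - x) * x / pi \<ge> 0" using x pi by auto
    \<comment> \<open>The right-hand side is below \<open>4\<close>; division by
      \<open>2 * pi\<close> then gives the inequality between \<open>pi / 2 - 1\<close> and
      \<open>2 / pi\<close>.\<close>
    moreover have "(pi - 2) * pi \<le> (3.15 - 2) * 3.15" using pi by (intro mult_mono) auto
    then have "pi / 2 - 1 \<le> 2 / pi" using pi by (simp add: field_simps)
    ultimately have "- (1 - pi / 4) \<le> g x" by linarith
    then show ?thesis using 1 by (simp add: abs_le_iff)
  qed
  have "res_kernel s = g (pi / 2 - s)" by (simp add: res_kernel_def g_def sin_diff
      diff_divide_distrib)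
  moreover have "g (- x) = - g x" for x by (simp add: g_def)
  from this[of "s - pi / 2"] have "g (pi / 2 - s) = - g (s - pi / 2)" by simp
  ultimately show ?thesis using bound[of "pi / 2 - s"] bound[of "s - pi / 2"] assms
    by (cases "s \<le> pi / 2") auto
qed

section \<open>Operators on bounded continuous functions\<close>

text \<open>Bounded continuous functions on the line with the sup norm form a Banach space;
  antiperiodicity is imposed later as a closed subset. For continuous kernels
  \<open>apply_conv_bc\<close> justifies the abstraction.\<close>

definition conv_bc :: "(real \<Rightarrow> real) \<Rightarrow> (real \<Rightarrow>\<^sub>C real) \<Rightarrow> (real \<Rightarrow>\<^sub>C real)" where
  "conv_bc \<kappa> u = Bcontfun (half_conv \<kappa> u)"

definition mult_bc :: "(real \<Rightarrow>\<^sub>C real) \<Rightarrow> (real \<Rightarrow>\<^sub>C real) \<Rightarrow> (real \<Rightarrow>\<^sub>C real)" where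
  "mult_bc u v = Bcontfun (\<lambda>t. u t * v t)"

definition cos_bc :: "real \<Rightarrow>\<^sub>C real" where "cos_bc = Bcontfun cos"
definition sin_bc :: "real \<Rightarrow>\<^sub>C real" where "sin_bc = Bcontfun sin"

abbreviation J :: "(real \<Rightarrow>\<^sub>C real) \<Rightarrow> (real \<Rightarrow>\<^sub>C real)" where
  "J \<equiv> conv_bc (\<lambda>_. 1 / 2)"

section \<open>Boundedness of convolutions, products and Fourier coefficients\<close>

lemma half_conv_continuous:
  assumes "continuous_on UNIV \<kappa>" shows "continuous_on UNIV (half_conv \<kappa> (apply_bcontfun u))"
proof -
  have "continuous_on (UNIV \<times> cbox 0 pi) (\<lambda>(t, s). \<kappa> s * apply_bcontfun u (t - s))"
    unfolding case_prod_unfold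
    by (intro continuous_intros continuous_on_compose2[OF assms] continuous_on_compose2[OF
        continuous_on_apply_bcontfun[of UNIV]]) auto
  from integral_continuous_on_param[OF this] show ?thesis
    unfolding half_conv_def[abs_def] by simp
qed

lemma half_conv_norm_le:
  assumes "continuous_on UNIV \<kappa>" "\<And>s. s \<in> {0..pi} \<Longrightarrow> \<bar>\<kappa> s\<bar> \<le> M"
  shows "norm (half_conv \<kappa> (apply_bcontfun u) t) \<le> M * pi * norm u"
proof -
  have "M \<ge> 0" using assms(2)[of 0] by (auto intro: order_trans)
  have "norm (half_conv \<kappa> (apply_bcontfun u) t) \<le> M * norm u * (pi - 0)"
    unfolding half_conv_def
  proof (rule integral_bound)
    show "continuous_on {0..pi} (\<lambda>s. \<kappa> s * apply_bcontfun u (t - s))"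
      by (intro continuous_intros continuous_on_compose2[OF assms(1)] continuous_on_compose2[OF
          continuous_on_apply_bcontfun[of UNIV]]) auto
    show "norm (\<kappa> s * apply_bcontfun u (t - s)) \<le> M * norm u" if "s \<in> {0..pi}" for s
      unfolding norm_mult using assms(2)[OF that] \<open>M \<ge> 0\<close> norm_bounded[of u]
      by (intro mult_mono) auto
  qed simp
  then show ?thesis by (simp add: mult_ac)
qed

lemma kernel_bounded:
  fixes \<kappa> :: "real \<Rightarrow> real"
  assumes "continuous_on UNIV \<kappa>" obtains M where "\<And>s. s \<in> {0..pi} \<Longrightarrow> \<bar>\<kappa> s\<bar> \<le> M"
proof -
  have "compact (\<kappa> ` {0..pi})"
    using assms by (intro compact_continuous_image) (auto intro: continuous_on_subset)
  then obtain M where "\<forall>x\<in>\<kappa> ` {0..pi}. norm x \<le> M"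
    using compact_imp_bounded bounded_iff by blast
  then show thesis by (intro that) auto
qed

lemma apply_conv_bc:
  assumes "continuous_on UNIV \<kappa>"
  shows "apply_bcontfun (conv_bc \<kappa> u) = half_conv \<kappa> (apply_bcontfun u)"
proof -
  obtain M where "\<And>s. s \<in> {0..pi} \<Longrightarrow> \<bar>\<kappa> s\<bar> \<le> M" using kernel_bounded[OF assms] by blast
  from bcontfun_normI[OF half_conv_continuous[OF assms] half_conv_norm_le[OF assms this]]
  show ?thesis unfolding conv_bc_def by (simp add: Bcontfun_inverse)
qed

lemma apply_antideriv_bc: "apply_bcontfun (J u) = antideriv (apply_bcontfun u)"
  by (simp add: apply_conv_bc antideriv_def)

lemma norm_conv_bc_le:
  assumes "continuous_on UNIV \<kappa>" "\<And>s. s \<in> {0..pi} \<Longrightarrow> \<bar>\<kappa> s\<bar> \<le> M"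
  shows "norm (conv_bc \<kappa> u) \<le> M * pi * norm u"
  by (rule norm_bound) (simp only: apply_conv_bc[OF assms(1)] half_conv_norm_le[OF assms])

lemma bounded_linear_conv_bc:
  assumes "continuous_on UNIV \<kappa>" shows "bounded_linear (conv_bc \<kappa>)"
proof -
  have i: "(\<lambda>s. \<kappa> s * apply_bcontfun u (t - s)) integrable_on {0..pi}" for u t
    by (intro integrable_continuous_real continuous_intros continuous_on_compose2[OF assms]
        continuous_on_compose2[OF continuous_on_apply_bcontfun[of UNIV]]) auto
  obtain M where M: "\<And>s. s \<in> {0..pi} \<Longrightarrow> \<bar>\<kappa> s\<bar> \<le> M" using kernel_bounded[OF assms] by blast
  show ?thesis
  proof (rule bounded_linear_intro[where K = "M * pi"])
    show "conv_bc \<kappa> (u + v) = conv_bc \<kappa> u + conv_bc \<kappa> v" for u v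
      by (rule bcontfun_eqI)
        (simp add: apply_conv_bc[OF assms] half_conv_def distrib_left integral_add[OF i i])
    show "conv_bc \<kappa> (r *\<^sub>R u) = r *\<^sub>R conv_bc \<kappa> u" for r u
      by (rule bcontfun_eqI)
        (simp add: apply_conv_bc[OF assms] half_conv_def mult.left_commute[of _ r])
    show "norm (conv_bc \<kappa> u) \<le> norm u * (M * pi)" for u
      using norm_conv_bc_le[OF assms M] by (simp add: mult_ac)
  qed
qed

lemma apply_mult_bc [simp]: "apply_bcontfun (mult_bc u v) t = u t * v t"
proof -
  have "norm (u t * v t) \<le> norm u * norm v" for t
    unfolding norm_mult by (intro mult_mono norm_bounded) auto
  then have "(\<lambda>t. u t * v t) \<in> bcontfun"
    by (intro bcontfun_normI[of _ "norm u * norm v"] continuous_intros) auto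
  then show ?thesis by (simp add: mult_bc_def Bcontfun_inverse)
qed

lemma bounded_bilinear_mult_bc: "bounded_bilinear mult_bc"
proof
  show "\<exists>K. \<forall>u v. norm (mult_bc u v) \<le> norm u * norm v * K"
  proof (intro exI[of _ 1] allI norm_bound)
    fix u v :: "real \<Rightarrow>\<^sub>C real" and t
    show "norm (apply_bcontfun (mult_bc u v) t) \<le> norm u * norm v * 1"
      by (simp only: apply_mult_bc norm_mult mult_1_right)
          (intro mult_mono norm_bounded norm_ge_zero)
  qed
qed (auto intro!: bcontfun_eqI simp: algebra_simps)

lemma apply_cos_bc [simp]: "apply_bcontfun cos_bc = cos"
  unfolding cos_bc_def by (intro Bcontfun_inverse bcontfun_normI[of _ 1] continuous_intros) auto

lemma apply_sin_bc [simp]: "apply_bcontfun sin_bc = sin"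
  unfolding sin_bc_def by (intro Bcontfun_inverse bcontfun_normI[of _ 1] continuous_intros) auto

lemma bounded_linear_mean:
  assumes "continuous_on UNIV \<kappa>"
  shows "bounded_linear (\<lambda>u. 2 / pi * integral {0..pi} (\<lambda>s. apply_bcontfun u s * \<kappa> s))"
proof -
  have i: "(\<lambda>s. apply_bcontfun u s * \<kappa> s) integrable_on {0..pi}" for u
    by (intro integrable_continuous_real continuous_intros continuous_on_subset[OF assms]) auto
  obtain M where M: "\<And>s. s \<in> {0..pi} \<Longrightarrow> \<bar>\<kappa> s\<bar> \<le> M" using kernel_bounded[OF assms] by blast
  have "\<bar>\<kappa> 0\<bar> \<le> M" by (rule M) simp
  then have "M \<ge> 0" by linarith
  show ?thesis
  proof (rule bounded_linear_intro[where K = "2 * M"])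
    fix u :: "real \<Rightarrow>\<^sub>C real"
    have "norm (integral {0..pi} (\<lambda>s. apply_bcontfun u s * \<kappa> s)) \<le> norm u * M * (pi - 0)"
    proof (rule integral_bound)
      show "norm (apply_bcontfun u s * \<kappa> s) \<le> norm u * M" if "s \<in> {0..pi}" for s
        unfolding norm_mult using M[OF that] \<open>M \<ge> 0\<close> norm_bounded[of u] by (intro mult_mono) auto
    qed (auto intro!: continuous_intros continuous_on_subset[OF assms])
    then show "norm (2 / pi * integral {0..pi} (\<lambda>s. apply_bcontfun u s * \<kappa> s)) \<le> norm u * (2 * M)"
      by (simp add: abs_mult field_simps)
  qed (simp_all add: distrib_right integral_add[OF i i] add_divide_distrib mult.assoc)
qed

lemma bounded_linear_fourier_cos: "bounded_linear (\<lambda>u. fourier_cos (apply_bcontfun u))"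
  unfolding fourier_cos_def by (intro bounded_linear_mean continuous_intros)

lemma bounded_linear_fourier_sin: "bounded_linear (\<lambda>u. fourier_sin (apply_bcontfun u))"
  unfolding fourier_sin_def by (intro bounded_linear_mean continuous_intros)

text \<open>Point evaluation is continuous in the sup norm, so the set is an intersection of closed
  sets.\<close>

lemma closed_antiperiodic: "closed {u :: real \<Rightarrow>\<^sub>C real. antiperiodic u}"
proof -
  have "continuous_on UNIV (\<lambda>u :: real \<Rightarrow>\<^sub>C real. u t)" for t
  proof (rule linear_continuous_on, rule bounded_linear_intro[where K = 1])
    show "norm (u t) \<le> norm u * 1" for u :: "real \<Rightarrow>\<^sub>C real"
      using norm_bounded[of u t] by simp
  qed auto
  then have "closed {u :: real \<Rightarrow>\<^sub>C real. u (t + pi) = - u t}" for t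
    by (intro closed_Collect_eq continuous_intros)
  then show ?thesis by (intro closed_Collect_all)
qed

section \<open>The fixed-point problem\<close>

lemma lip_cont_mult:
  fixes f g :: "'p \<Rightarrow> 'u::real_normed_vector \<Rightarrow> real"
  shows "lip_cont F f l \<Longrightarrow> lip_cont F g m \<Longrightarrow> lip_cont F (\<lambda>e u. f e u * g e u) (l * m)"
  by (rule lip_cont_bilinear[OF bounded_bilinear_mult])

lemma flat_mult:
  fixes f g :: "'p \<Rightarrow> 'u::real_normed_vector \<Rightarrow> real"
  shows "flat F f \<Longrightarrow> lip_cont F g m \<Longrightarrow> flat F (\<lambda>e u. f e u * g e u)"
  by (rule flat_bilinear_left[OF bounded_bilinear_mult])

lemma antideriv_bc_antiperiodic:
  "antiperiodic (apply_bcontfun u) \<Longrightarrow> antiperiodic (apply_bcontfun (J u))"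
  unfolding apply_antideriv_bc by (rule antideriv_antiperiodic)

lemma fourier_cos_antideriv_bc:
  "antiperiodic (apply_bcontfun u) \<Longrightarrow>
    fourier_cos (apply_bcontfun (J u)) = - fourier_sin (apply_bcontfun u)"
  unfolding apply_antideriv_bc by (rule fourier_cos_antideriv) auto

lemma fourier_sin_antideriv_bc:
  "antiperiodic (apply_bcontfun u) \<Longrightarrow>
    fourier_sin (apply_bcontfun (J u)) = fourier_cos (apply_bcontfun u)"
  unfolding apply_antideriv_bc by (rule fourier_sin_antideriv) auto

lemma antideriv_cos_bc: "J cos_bc = sin_bc"
  and antideriv_sin_bc: "J sin_bc = - cos_bc"
  by (rule bcontfun_eqI; simp add: apply_antideriv_bc antideriv_cos antideriv_sin)+

lemma continuous_res_kernel: "continuous_on UNIV res_kernel"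
  unfolding res_kernel_def[abs_def] by (intro continuous_intros) auto

lemma bounded_linear_J: "bounded_linear J"
  by (rule bounded_linear_conv_bc) simp

text \<open>The kernel bound times \<open>pi\<close> is below \<open>0.678\<close>; the value
  \<open>7 / 10\<close> leaves room for two perturbations with Lipschitz constant
  \<open>1 / 10\<close>.\<close>

lemma norm_conv_res_kernel_le: "norm (conv_bc res_kernel u) \<le> 7 / 10 * norm u"
proof -
  have pi: "3.14 < pi" "pi < 3.15" using pi_approx by simp_all
  have "norm (conv_bc res_kernel u) \<le> (1 - pi / 4) * pi * norm u"
    using norm_conv_bc_le[OF continuous_res_kernel res_kernel_bound] .
  moreover have "(1 - pi / 4) * pi \<le> (1 - 3.14 / 4) * 3.15"
    using pi by (intro mult_mono) auto
  then have "(1 - pi / 4) * pi * norm u \<le> 7 / 10 * norm u" by (intro mult_right_mono) auto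
  ultimately show ?thesis by linarith
qed

lemma conv_res_kernel_eq:
  assumes "antiperiodic (apply_bcontfun u)"
  shows "conv_bc res_kernel u = J (J u)
    + (fourier_cos u *\<^sub>R cos_bc + fourier_sin u *\<^sub>R sin_bc)"
  by (rule bcontfun_eqI)
    (simp add: apply_conv_bc[OF continuous_res_kernel] half_conv_res_kernel assms
        apply_antideriv_bc)

definition off_res :: "(real \<Rightarrow>\<^sub>C real) \<Rightarrow> (real \<Rightarrow>\<^sub>C real)" where
  "off_res u = u - (fourier_cos u *\<^sub>R cos_bc + fourier_sin u *\<^sub>R sin_bc)"

lemma bounded_linear_off_res: "bounded_linear off_res"
  unfolding off_res_def[abs_def]
  by (intro bounded_linear_sub bounded_linear_add bounded_linear_ident
      bounded_linear_compose[OF bounded_linear_scaleR_left] bounded_linear_fourier_cos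
      bounded_linear_fourier_sin)

lemma fourier_add:
  fixes u v :: "real \<Rightarrow>\<^sub>C real"
  shows "fourier_cos (u + v) = fourier_cos u + fourier_cos v"
    "fourier_sin (u + v) = fourier_sin u + fourier_sin v"
    "fourier_cos (u - v) = fourier_cos u - fourier_cos v"
    "fourier_sin (u - v) = fourier_sin u - fourier_sin v"
    "fourier_cos (- u) = - fourier_cos u"
    "fourier_sin (- u) = - fourier_sin u"
    "fourier_cos (r *\<^sub>R u) = r * fourier_cos u"
    "fourier_sin (r *\<^sub>R u) = r * fourier_sin u"
  using linear_simps[OF bounded_linear_fourier_cos] linear_simps[OF bounded_linear_fourier_sin]
  by simp_all

declare fourier_cos_cos [simp] fourier_sin_cos [simp] fourier_cos_sin [simp] fourier_sin_sin [simp]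

definition cube_bc :: "(real \<Rightarrow>\<^sub>C real) \<Rightarrow> (real \<Rightarrow>\<^sub>C real)" where
  "cube_bc u = mult_bc (mult_bc u u) u"

lemma apply_cube_bc: "apply_bcontfun (cube_bc u) t = u t ^ 3"
  by (simp add: cube_bc_def power3_eq_cube)

lemma fourier_cube_cos_bc: "fourier_cos (cube_bc cos_bc) = 3 / 4" "fourier_sin (cube_bc cos_bc) = 0"
  using fourier_cos_cos_cubed fourier_sin_cos_cubed by (simp_all add: apply_cube_bc[abs_def])

section \<open>Fixed-point iteration, given only the limits of the coefficients along a
  filter\<close>

context
  fixes F :: "'p filter" and p q s \<alpha> \<gamma> \<nu> :: "'p \<Rightarrow> real" and \<omega> \<alpha>\<^sub>0 \<nu>\<^sub>0 :: real
  assumes lim: "(p \<longlongrightarrow> 0) F" "(s \<longlongrightarrow> 0) F" "(\<gamma> \<longlongrightarrow> 0) F" "(q \<longlongrightarrow> \<omega>\<^sup>2) F"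
      "(\<alpha> \<longlongrightarrow> \<alpha>\<^sub>0) F" "(\<nu> \<longlongrightarrow> \<nu>\<^sub>0) F"
    and nz: "\<omega> > 0" "\<nu>\<^sub>0 \<noteq> 0"
begin

text \<open>A state \<open>u = (\<tau>, D)\<close> stands for the time scale \<open>1 / \<omega> + \<tau>\<close> and the profile \<open>cos + D\<close>.
  The amplitude solves the sine equation, the next \<open>\<tau>\<close> is a Newton step for the cosine equation.
  As \<open>off_res\<close> annihilates the first harmonics, \<open>rem\<close> may act on \<open>D\<close> instead of \<open>cos + D\<close>.\<close>

definition "per u = 1 / \<omega> + fst u" for u :: "real \<times> (real \<Rightarrow>\<^sub>C real)"
definition "prof u = cos_bc + snd u" for u :: "real \<times> (real \<Rightarrow>\<^sub>C real)"
definition "cub u = cube_bc (prof u)"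
text \<open>The coefficient of the amplitude in the sine equation after division by
  \<open>per u\<close>. Differences that involve the state are written as sums with negated factors,
  to match the rules for sums and products.\<close>

definition "den e u = \<nu> e * (fourier_cos (cub u) + - \<alpha> e * per u * fourier_sin (cub u)
    + - \<gamma> e * (per u * per u) * fourier_cos (cub u))"
definition "amp e u = (- p e + - s e * (per u * per u)) * inverse (den e u)"
definition "force e u = per u *\<^sub>R J (cub u) + (\<alpha> e * (per u * per u)) *\<^sub>R J (J (cub u))
    + (\<gamma> e * (per u * per u * per u)) *\<^sub>R J (J (J (cub u)))"
definition "rem e u = (p e * per u) *\<^sub>R J (snd u) + (q e * (per u * per u) + - 1) *\<^sub>R J (J (snd u))
    + (- s e * (per u * per u * per u)) *\<^sub>R J (J (J (snd u))) + (amp e u * \<nu> e) *\<^sub>R force e u"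
definition "next_per e u = ((1 - q e * (1 / \<omega>\<^sup>2)) + (fst u * fst u) * - q e
    + amp e u * (per u * \<nu> e * (- 1 * fourier_sin (cub u) + - \<alpha> e * per u * fourier_cos (cub u)
      + \<gamma> e * (per u * per u) * fourier_sin (cub u)))) * (\<omega> * inverse (2 * q e))"

section \<open>Limits and flatness of the terms of the iteration\<close>

lemma lip_per: "lip_cont F (\<lambda>e. per) (1 / \<omega>)"
  using lip_cont_add[OF lip_cont_const[OF tendsto_const] lip_cont_bounded_linear[OF
      bounded_linear_fst]]
  by (simp add: per_def[abs_def])

lemma lip_prof: "lip_cont F (\<lambda>e. prof) cos_bc"
  using lip_cont_add[OF lip_cont_const[OF tendsto_const] lip_cont_bounded_linear[OF
      bounded_linear_snd]]
  by (simp add: prof_def[abs_def])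

lemma lip_cub: "lip_cont F (\<lambda>e. cub) (cube_bc cos_bc)"
  unfolding cub_def[abs_def] cube_bc_def
  by (intro lip_cont_bilinear[OF bounded_bilinear_mult_bc] lip_prof)

lemma lip_A: "lip_cont F (\<lambda>e u. fourier_cos (cub u)) (3 / 4)"
  and lip_B: "lip_cont F (\<lambda>e u. fourier_sin (cub u)) 0"
  using lip_cont_linear_compose[OF bounded_linear_fourier_cos lip_cub]
    lip_cont_linear_compose[OF bounded_linear_fourier_sin lip_cub]
  by (simp_all add: fourier_cube_cos_bc)

lemma lip_den: "lip_cont F den (\<nu>\<^sub>0 * (3 / 4))"
proof -
  have "lip_cont F den (\<nu>\<^sub>0 * (3 / 4 + - \<alpha>\<^sub>0 * (1 / \<omega>) * 0 + - 0 * (1 / \<omega> * (1 / \<omega>)) * (3 / 4)))"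
    unfolding den_def[abs_def]
    by (intro lip_cont_mult lip_cont_add lip_cont_const tendsto_minus lim lip_per lip_A lip_B)
  then show ?thesis by simp
qed

text \<open>The numerator is flat because \<open>p\<close> and \<open>s\<close> tend to zero, and
  the denominator stays away from zero by \<open>lip_den\<close>.\<close>

lemma flat_amp: "flat F amp"
proof -
  have 1: "((\<lambda>e. - p e) \<longlongrightarrow> 0) F" "((\<lambda>e. - s e) \<longlongrightarrow> 0) F"
    using tendsto_minus[OF lim(1)] tendsto_minus[OF lim(2)] by auto
  show ?thesis unfolding amp_def[abs_def]
    by (rule flat_mult[OF flat_add[OF flat_const[OF 1(1)] flat_mult[OF flat_const[OF 1(2)]
        lip_cont_mult[OF lip_per lip_per]]]
      lip_cont_inverse[OF lip_den]]) (use nz in simp)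
qed

lemma lip_force: "\<exists>l. lip_cont F force l"
proof -
  let ?Z = "cube_bc cos_bc" and ?w = "1 / \<omega>"
  have "lip_cont F force (?w *\<^sub>R J ?Z + (\<alpha>\<^sub>0 * (?w * ?w)) *\<^sub>R J (J ?Z) + (0 * (?w * ?w * ?w)) *\<^sub>R
      J (J (J ?Z)))"
    unfolding force_def[abs_def]
    by (intro lip_cont_add lip_cont_bilinear[OF bounded_bilinear_scaleR] lip_cont_mult lip_per
        lip_cont_const[OF lim(5)] lip_cont_const[OF lim(3)] lip_cont_linear_compose[OF
            bounded_linear_J] lip_cub)
  then show ?thesis by blast
qed

text \<open>The three summands are small for different reasons: \<open>q\<close> tends to
  \<open>\<omega>\<^sup>2\<close>, the square of \<open>fst u\<close> is a product of two vanishing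
  factors, and \<open>amp\<close> is flat.\<close>

lemma flat_next_per: "flat F next_per"
proof -
  have 1: "((\<lambda>e. 1 - q e * (1 / \<omega>\<^sup>2)) \<longlongrightarrow> 0) F"
    using tendsto_diff[OF tendsto_const[of 1] tendsto_mult_right[OF lim(4), of "1 / \<omega>\<^sup>2"]] nz
        by simp
  have 2: "((\<lambda>e. \<omega> * inverse (2 * q e)) \<longlongrightarrow> \<omega> * inverse (2 * \<omega>\<^sup>2)) F"
    using nz by (intro tendsto_intros lim) auto
  have 3: "((\<lambda>e. - q e) \<longlongrightarrow> - \<omega>\<^sup>2) F" by (intro tendsto_intros lim)
  have 4: "((\<lambda>e. - \<alpha> e) \<longlongrightarrow> - \<alpha>\<^sub>0) F" by (intro tendsto_intros lim)
  have f: "lip_cont F (\<lambda>e u :: real \<times> (real \<Rightarrow>\<^sub>C real). fst u) 0"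
    by (rule lip_cont_bounded_linear[OF bounded_linear_fst])
  let ?w = "1 / \<omega>"
  have 5: "lip_cont F (\<lambda>e u. per u * \<nu> e * (- 1 * fourier_sin (cub u) +
      - \<alpha> e * per u * fourier_cos (cub u)
      + \<gamma> e * (per u * per u) * fourier_sin (cub u)))
      (?w * \<nu>\<^sub>0 * (- 1 * 0 + - \<alpha>\<^sub>0 * ?w * (3 / 4) + 0 * (?w * ?w) * 0))"
    by (intro lip_cont_mult lip_cont_add lip_per lip_A lip_B lip_cont_const[OF lim(3)]
        lip_cont_const[OF lim(6)] lip_cont_const[OF 4] lip_cont_const[OF tendsto_const])
  show ?thesis
    unfolding next_per_def[abs_def]
    by (rule flat_mult[OF flat_add[OF flat_add[OF flat_const[OF 1] flat_mult[OF
          flat_bilinear_vanishing[OF bounded_bilinear_mult f f] lip_cont_const[OF 3]]]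
          flat_mult[OF flat_amp 5]] lip_cont_const[OF 2]])
qed

text \<open>The summands with \<open>p\<close> and \<open>s\<close> have vanishing coefficients, and
  the last contains \<open>amp\<close>. The second is a product of two vanishing factors: its
  coefficient tends to zero by the limits of \<open>q\<close> and \<open>per\<close>, and its
  function is linear in \<open>snd u\<close>.\<close>

lemma flat_rem: "flat F rem"
proof -
  have s: "((\<lambda>e. - s e) \<longlongrightarrow> 0) F" using tendsto_minus[OF lim(2)] by auto
  have "lip_cont F (\<lambda>e u. q e * (per u * per u) + - 1) (\<omega>\<^sup>2 * (1 / \<omega> * (1 / \<omega>)) + - 1)"
    by (intro lip_cont_add lip_cont_mult lip_per lip_cont_const lim tendsto_const)
  then have q: "lip_cont F (\<lambda>e u. q e * (per u * per u) + - 1) 0"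
    using nz by (simp add: power2_eq_square)
  have D: "lip_cont F (\<lambda>e u :: real \<times> (real \<Rightarrow>\<^sub>C real). snd u) 0"
    by (rule lip_cont_bounded_linear[OF bounded_linear_snd])
  note J = lip_cont_linear_compose[OF bounded_linear_J]
  obtain l where l: "lip_cont F force l" using lip_force by blast
  have JJ: "lip_cont F (\<lambda>e u :: real \<times> (real \<Rightarrow>\<^sub>C real). J (J (snd u))) 0"
    using J[OF J[OF D]] by (simp add: linear_simps(3)[OF bounded_linear_J])
  show ?thesis unfolding rem_def[abs_def]
    by (rule flat_add[OF flat_add[OF flat_add[OF
        flat_bilinear_left[OF bounded_bilinear_scaleR flat_mult[OF flat_const[OF lim(1)] lip_per]
            J[OF D]]
        flat_bilinear_vanishing[OF bounded_bilinear_scaleR q JJ]]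
        flat_bilinear_left[OF bounded_bilinear_scaleR flat_mult[OF flat_const[OF s]
            lip_cont_mult[OF lip_cont_mult[OF lip_per lip_per] lip_per]] J[OF J[OF J[OF D]]]]]
        flat_bilinear_left[OF bounded_bilinear_scaleR flat_mult[OF flat_amp lip_cont_const[OF
            lim(6)]] l]])
qed

text \<open>The inverse of \<open>1 + J\<^sup>2\<close> off resonance is avoided: \<open>J\<^sup>2\<close> itself stays in the iteration, with
  norm less than one. A fixed point has no first harmonics although the states are not restricted
  to such functions.\<close>

definition "next_state e u =
  (next_per e u, - conv_bc res_kernel (snd u) + - 1 *\<^sub>R off_res (rem e u))"

text \<open>The constants add up: \<open>7 / 10\<close> from \<open>conv_bc res_kernel\<close> and
  \<open>1 / 10\<close> from each of the two flat maps.\<close>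

lemma lip_near_next_state: "lip_near F next_state (9 / 10)"
proof -
  have T: "bounded_linear (conv_bc res_kernel)"
    by (rule bounded_linear_conv_bc[OF continuous_res_kernel])
  have "norm (- conv_bc res_kernel (snd u) - - conv_bc res_kernel (snd v)) \<le> 7 / 10 * norm (u - v)"
    for u v :: "real \<times> (real \<Rightarrow>\<^sub>C real)"
  proof -
    have "- conv_bc res_kernel (snd u) - - conv_bc res_kernel (snd v)
        = - conv_bc res_kernel (snd (u - v))"
      by (simp add: linear_simps[OF T])
    then have "norm (- conv_bc res_kernel (snd u) - - conv_bc res_kernel (snd v))
        \<le> 7 / 10 * norm (snd (u - v))"
      using norm_conv_res_kernel_le[of "snd (u - v)"] by simp
    moreover have "norm (snd (u - v)) \<le> norm (u - v)" by (metis norm_snd_le prod.collapse)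
    ultimately show ?thesis by linarith
  qed
  then have 1: "lip_near F (\<lambda>e u :: real \<times> (real \<Rightarrow>\<^sub>C real). - conv_bc res_kernel (snd u)) (7 / 10)"
    unfolding lip_near_def by (simp add: case_prod_unfold)
  have "bounded_linear (\<lambda>h. - 1 *\<^sub>R off_res h)"
    using bounded_linear_minus[OF bounded_linear_off_res] by simp
  from flat_linear_compose[OF this flat_rem]
  have 2: "lip_near F (\<lambda>e u. - 1 *\<^sub>R off_res (rem e u)) (1 / 10)"
    unfolding flat_def by simp
  have 3: "lip_near F next_per (1 / 10)" using flat_next_per unfolding flat_def by simp
  show ?thesis using lip_near_Pair[OF 3 lip_near_add[OF 1 2]] by (simp add: next_state_def[abs_def])
qed

lemma next_state_tendsto_0: "((\<lambda>e. next_state e 0) \<longlongrightarrow> 0) F"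
proof -
  have "((\<lambda>e. (next_per e 0, - conv_bc res_kernel 0 + - 1 *\<^sub>R off_res (rem e 0)))
      \<longlongrightarrow> (0, - conv_bc res_kernel 0 + - 1 *\<^sub>R off_res 0)) F"
    using flat_next_per flat_rem unfolding flat_def
    by (intro tendsto_intros bounded_linear.tendsto[OF bounded_linear_off_res]) auto
  then show ?thesis
    by (simp add: next_state_def zero_prod_def linear_simps(3)[OF bounded_linear_off_res]
        linear_simps(3)[OF bounded_linear_conv_bc[OF continuous_res_kernel]])
qed

section \<open>Invariance of the antiperiodic states\<close>

abbreviation "states \<equiv> (UNIV :: real set) \<times> {D :: real \<Rightarrow>\<^sub>C real. antiperiodic D}"

lemma prof_antiperiodic: "u \<in> states \<Longrightarrow> antiperiodic (prof u)"
  by (auto simp: prof_def)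

lemma cub_antiperiodic: "u \<in> states \<Longrightarrow> antiperiodic (cub u)"
  using prof_antiperiodic by (auto simp: cub_def apply_cube_bc)

lemma force_antiperiodic: "u \<in> states \<Longrightarrow> antiperiodic (force e u)"
  using cub_antiperiodic[of u] by (simp add: force_def antideriv_bc_antiperiodic algebra_simps)

lemma rem_antiperiodic: "u \<in> states \<Longrightarrow> antiperiodic (rem e u)"
  using force_antiperiodic[of u e]
  by (auto simp add: rem_def antideriv_bc_antiperiodic algebra_simps)

lemma next_state_states: "u \<in> states \<Longrightarrow> next_state e u \<in> states"
  using rem_antiperiodic[of u e]
  by (auto simp: next_state_def off_res_def conv_res_kernel_eq antideriv_bc_antiperiodic
      algebra_simps)

lemma fixed_point_exists:
  "\<exists>u. (u \<longlongrightarrow> 0) F \<and> (\<forall>\<^sub>F e in F. u e \<in> states \<and> next_state e (u e) = u e)"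
proof (rule small_fixed_point[OF lip_near_next_state _ _ next_state_tendsto_0])
  show "\<forall>\<^sub>F e in F. \<forall>u\<in>states. next_state e u \<in> states" using next_state_states by simp
qed (auto intro!: closed_Times closed_antiperiodic simp: zero_prod_def)

text \<open>The equation splits into cosine, sine and off-resonance components. The choice of
  \<open>amp\<close> solves the sine part, the fixed-point property of \<open>fst u\<close> the
  cosine part, and that of \<open>snd u\<close> the rest.\<close>

lemma fixed_point_equation:
  assumes u: "u \<in> states" "next_state e u = u" and ne: "den e u \<noteq> 0" "q e \<noteq> 0"
  shows "fourier_cos (prof u) = 1"
    and "prof u + (p e * per u) *\<^sub>R J (prof u) + (q e * per u ^ 2) *\<^sub>R J (J (prof u))
      - (s e * per u ^ 3) *\<^sub>R J (J (J (prof u))) + (amp e u * \<nu> e) *\<^sub>R force e u = 0"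
proof -
  define D where "D = snd u"
  have D: "antiperiodic D" using u(1) by (auto simp: D_def)
  note JD = antideriv_bc_antiperiodic[OF D]
  note JJD = antideriv_bc_antiperiodic[OF JD]
  note Z = cub_antiperiodic[OF u(1)]
  note JZ = antideriv_bc_antiperiodic[OF Z]
  note JJZ = antideriv_bc_antiperiodic[OF JZ]
  note fc = fourier_cos_antideriv_bc fourier_sin_antideriv_bc
  have eq: "D = - conv_bc res_kernel D - off_res (rem e u)"
    using u(2) by (simp add: next_state_def D_def prod_eq_iff)
  \<comment> \<open>Applying \<open>J\<close> twice negates first harmonics, so
    \<open>conv_bc res_kernel D\<close> has none, and neither has an image of
    \<open>off_res\<close>; hence \<open>D\<close> has none.\<close>
  have "fourier_cos D = 0 \<and> fourier_sin D = 0"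
  proof -
    have "fourier_cos D = fourier_cos (- conv_bc res_kernel D - off_res (rem e u))"
      "fourier_sin D = fourier_sin (- conv_bc res_kernel D - off_res (rem e u))"
      using eq by simp_all
    then show ?thesis
      unfolding conv_res_kernel_eq[OF D] off_res_def fourier_add fc[OF JD] fc[OF D]
      by simp
  qed
  then have D0: "fourier_cos D = 0" "fourier_sin D = 0" by auto
  show "fourier_cos (prof u) = 1"
    unfolding prof_def fourier_add D_def[symmetric] D0 by simp
  define w A B L where "w = per u" and "A = fourier_cos (cub u)" and "B = fourier_sin (cub u)"
    and "L = amp e u"
  have force: "fourier_cos (force e u) = - w * B - \<alpha> e * w ^ 2 * A + \<gamma> e * w ^ 3 * B"
    "fourier_sin (force e u) = w * A - \<alpha> e * w ^ 2 * B - \<gamma> e * w ^ 3 * A"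
    unfolding force_def fourier_add fc[OF JJZ] fc[OF JZ] fc[OF Z] w_def A_def B_def
    by (simp_all add: power2_eq_square power3_eq_cube)
  have rem: "fourier_cos (rem e u) = L * \<nu> e * (- w * B - \<alpha> e * w ^ 2 * A + \<gamma> e * w ^ 3 * B)"
    "fourier_sin (rem e u) = L * \<nu> e * (w * A - \<alpha> e * w ^ 2 * B - \<gamma> e * w ^ 3 * A)"
    unfolding rem_def fourier_add fc[OF JJD] fc[OF JD] fc[OF D] force D_def[symmetric] D0 L_def
        by simp_all
  \<comment> \<open>The definition of \<open>amp\<close> with its denominator cleared; the factor
    \<open>w\<close> divided out in \<open>den\<close> is restored afterwards.\<close>
  have "L * den e u = - p e - s e * w ^ 2"
    using ne by (simp add: L_def amp_def w_def power2_eq_square)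
  then have "w * (L * den e u) = w * (- p e - s e * w ^ 2)" by (simp only:)
  then have sin_eq: "p e * w + s e * w ^ 3 + fourier_sin (rem e u) = 0"
    unfolding rem den_def A_def[symmetric] B_def[symmetric] w_def[symmetric]
    by (simp add: algebra_simps power2_eq_square power3_eq_cube)
  have w: "w = 1 / \<omega> + fst u" by (simp add: w_def per_def)
  have "next_per e u = fst u" using u(2) by (simp add: next_state_def prod_eq_iff)
  \<comment> \<open>\<open>next_per\<close> solves the cosine equation for the linear term in the
    expansion of \<open>q e * (1 / \<omega> + fst u) ^ 2\<close>; this undoes the division.\<close>
  then have "2 * q e * fst u / \<omega> = (1 - q e * (1 / \<omega>\<^sup>2)) + (fst u * fst u) * - q e
    + L * (w * \<nu> e * (- 1 * B + - \<alpha> e * w * A + \<gamma> e * (w * w) * B))"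
    unfolding next_per_def A_def[symmetric] B_def[symmetric] w_def[symmetric] L_def[symmetric]
    using ne nz by (simp add: field_simps)
  then have "1 - q e * (1 / \<omega> + fst u) ^ 2
      + L * (w * \<nu> e * (- 1 * B + - \<alpha> e * w * A + \<gamma> e * (w * w) * B)) = 0"
    using nz by (simp add: field_simps power2_eq_square)
  then have cos_eq: "1 - q e * w ^ 2 + fourier_cos (rem e u) = 0"
    unfolding rem w[symmetric] by (simp add: algebra_simps power2_eq_square power3_eq_cube)
  note lin = linear_simps[OF bounded_linear_J]
  \<comment> \<open>Repeated application of \<open>J\<close> to \<open>cos\<close> gives
    \<open>sin\<close>, \<open>- cos\<close> and \<open>- sin\<close>, which supply the terms
    outside \<open>rem\<close>. The \<open>- 1\<close> in \<open>rem\<close> compensates for the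
    summand \<open>J (J D)\<close>.\<close>
  have "prof u + (p e * w) *\<^sub>R J (prof u) + (q e * w ^ 2) *\<^sub>R J (J (prof u))
      - (s e * w ^ 3) *\<^sub>R J (J (J (prof u))) + (L * \<nu> e) *\<^sub>R force e u
    = (D + J (J D) + off_res (rem e u)) + (1 - q e * w ^ 2 + fourier_cos (rem e u)) *\<^sub>R cos_bc
      + (p e * w + s e * w ^ 3 + fourier_sin (rem e u)) *\<^sub>R sin_bc"
    unfolding off_res_def rem_def[of e u] prof_def lin antideriv_cos_bc antideriv_sin_bc
        D_def[symmetric] w_def[symmetric]
      L_def[symmetric]
    by (rule bcontfun_eqI) (simp add: algebra_simps power2_eq_square power3_eq_cube)
  also have "\<dots> = 0" unfolding cos_eq sin_eq using eq unfolding conv_res_kernel_eq[OF D] D0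
    by (simp add: algebra_simps eq_neg_iff_add_eq_0)
  finally show "prof u + (p e * per u) *\<^sub>R J (prof u) + (q e * per u ^ 2) *\<^sub>R J (J (prof u))
      - (s e * per u ^ 3) *\<^sub>R J (J (J (prof u))) + (amp e u * \<nu> e) *\<^sub>R force e u = 0"
    by (simp add: w_def L_def)
qed

text \<open>The factor \<open>d\<close> is exposed so that the sign of the amplitude can be read off
  from \<open>a e * d e\<close>; at this stage \<open>a\<close> may have either sign. The unit
  cosine coefficient excludes the zero profile.\<close>

lemma oscillation_profile:
  "\<exists>w a X d. (w \<longlongrightarrow> 1 / \<omega>) F \<and> (a \<longlongrightarrow> 0) F \<and> (X \<longlongrightarrow> cos_bc) F \<and> (d \<longlongrightarrow> \<nu>\<^sub>0 * (3 / 4)) F \<and>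
    (\<forall>\<^sub>F e in F. antiperiodic (X e) \<and> fourier_cos (X e) = 1 \<and>
      a e * d e = - (p e + s e * w e ^ 2) \<and>
      X e + (p e * w e) *\<^sub>R J (X e) + (q e * w e ^ 2) *\<^sub>R J (J (X e)) - (s e * w e ^ 3) *\<^sub>R J (J
          (J (X e)))
        + (a e * \<nu> e) *\<^sub>R (w e *\<^sub>R J (cube_bc (X e)) + (\<alpha> e * w e ^ 2) *\<^sub>R J (J (cube_bc (X e)))
          + (\<gamma> e * w e ^ 3) *\<^sub>R J (J (J (cube_bc (X e))))) = 0)"
proof -
  obtain u where u: "(u \<longlongrightarrow> 0) F" "\<forall>\<^sub>F e in F. u e \<in> states \<and> next_state e (u e) = u e"
    using fixed_point_exists by blast
  note t = lip_cont_tendsto_compose[OF _ u(1)]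
  have d: "((\<lambda>e. den e (u e)) \<longlongrightarrow> \<nu>\<^sub>0 * (3 / 4)) F" by (rule t[OF lip_den])
  have "\<forall>\<^sub>F e in F. den e (u e) \<noteq> 0" using tendsto_imp_eventually_ne[OF d] nz by simp
  moreover have "\<forall>\<^sub>F e in F. q e \<noteq> 0" using tendsto_imp_eventually_ne[OF lim(4)] nz by simp
  ultimately have "\<forall>\<^sub>F e in F. antiperiodic (prof (u e)) \<and> fourier_cos (prof (u e)) = 1 \<and>
      amp e (u e) * den e (u e) = - (p e + s e * per (u e) ^ 2) \<and>
      prof (u e) + (p e * per (u e)) *\<^sub>R J (prof (u e)) + (q e * per (u e) ^ 2) *\<^sub>R J (J (prof (u
          e)))
      - (s e * per (u e) ^ 3) *\<^sub>R J (J (J (prof (u e)))) + (amp e (u e) * \<nu> e) *\<^sub>R force e (u e)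
          = 0"
    using u(2)
  proof eventually_elim
    case (elim e)
    then show ?case using fixed_point_equation[of "u e" e] prof_antiperiodic[of "u e"]
      by (simp add: amp_def power2_eq_square)
  qed
  then have "\<forall>\<^sub>F e in F. antiperiodic (prof (u e)) \<and> fourier_cos (prof (u e)) = 1 \<and>
      amp e (u e) * den e (u e) = - (p e + s e * per (u e) ^ 2) \<and>
      prof (u e) + (p e * per (u e)) *\<^sub>R J (prof (u e)) + (q e * per (u e) ^ 2) *\<^sub>R J (J (prof (u
          e)))
      - (s e * per (u e) ^ 3) *\<^sub>R J (J (J (prof (u e))))
      + (amp e (u e) * \<nu> e) *\<^sub>R (per (u e) *\<^sub>R J (cube_bc (prof (u e)))
        + (\<alpha> e * per (u e) ^ 2) *\<^sub>R J (J (cube_bc (prof (u e))))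
        + (\<gamma> e * per (u e) ^ 3) *\<^sub>R J (J (J (cube_bc (prof (u e)))))) = 0"
    by (simp add: force_def cub_def power2_eq_square power3_eq_cube)
  with t[OF lip_per] t[OF lip_prof] d t[OF flat_imp_lip_cont[OF flat_amp]] show ?thesis
    by blast
qed

end

section \<open>The differential system\<close>

lemma smooth_near_0_DERIV:
  assumes "smooth_near_0 f" shows "(f has_real_derivative taylor_coeff f 1) (at 0)"
proof -
  obtain r where "r > 0" "\<And>n x. x \<in> {-r<..<r} \<Longrightarrow> ((deriv ^^ n) f) field_differentiable (at x)"
    using assms unfolding smooth_near_0_def by blast
  from this(2)[of 0 0] this(1) have "f field_differentiable (at 0)" by simp
  then show ?thesis by (simp add: taylor_coeff_def DERIV_deriv_iff_field_differentiable)
qed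

lemma taylor_coeff_0: "taylor_coeff f 0 = f 0"
  by (simp add: taylor_coeff_def)

lemma DERIV_tendsto_at_right:
  fixes f :: "real \<Rightarrow> real"
  assumes "(f has_real_derivative f') (at 0)" shows "(f \<longlongrightarrow> f 0) (at_right 0)"
  using DERIV_isCont[OF assms] by (auto simp: isCont_def intro: tendsto_within_subset)

lemma DERIV_quotient_at_right:
  fixes f :: "real \<Rightarrow> real"
  assumes "(f has_real_derivative f') (at 0)" "f 0 = 0"
  shows "((\<lambda>e. f e / e) \<longlongrightarrow> f') (at_right 0)"
  using assms by (auto simp: has_field_derivative_iff intro: tendsto_within_subset)

text \<open>Reverses the elimination: differentiating the integrated equation gives the first
  equation of the system with \<open>Y\<close> as scaled second component, and \<open>M\<close>, a
  primitive of \<open>Y\<close>, is the scaled third component.\<close>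

lemma profile_solution:
  fixes x J1 J2 J3 K1 K2 K3 :: "real \<Rightarrow> real"
  assumes D: "\<And>t. (J1 has_real_derivative x t) (at t)" "\<And>t. (J2 has_real_derivative J1 t) (at t)"
      "\<And>t. (J3 has_real_derivative J2 t) (at t)" "\<And>t. (K1 has_real_derivative x t ^ 3) (at t)"
      "\<And>t. (K2 has_real_derivative K1 t) (at t)" "\<And>t. (K3 has_real_derivative K2 t) (at t)"
    and eq: "\<And>t. x t + p * w * J1 t + q * w ^ 2 * J2 t - s * w ^ 3 * J3 t
      + r ^ 2 * \<nu> * (w * K1 t + \<alpha> * w ^ 2 * K2 t + \<gamma> * w ^ 3 * K3 t) = 0"
    and par: "\<gamma> = h * \<beta>" "p = \<alpha> - \<nu> * \<mu>" "q = \<gamma> - \<nu> * k - \<alpha> * \<mu> * \<nu>" "s = \<gamma> * \<nu> * \<mu>"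
    and nz: "w \<noteq> 0" "\<nu> \<noteq> 0"
  defines "Y \<equiv> \<lambda>t. - \<alpha> * x t - q * w * J1 t + s * w ^ 2 * J2 t - r ^ 2 * \<nu> * (\<alpha> * w * K1 t
      + \<gamma> * w ^ 2 * K2 t)"
    and "M \<equiv> \<lambda>t. - \<alpha> * J1 t - q * w * J2 t + s * w ^ 2 * J3 t - r ^ 2 * \<nu> * (\<alpha> * w * K2 t
        + \<gamma> * w ^ 2 * K3 t)"
  shows "solution (vector_field h k \<alpha> \<beta> \<mu> \<nu>)
    (\<lambda>t. (r * x (t / w), r / \<nu> * Y (t / w), \<beta> * r * w / \<nu> * M (t / w)))"
proof -
  define X' where "X' t = - (p * w * x t + q * w ^ 2 * J1 t - s * w ^ 3 * J2 t
      + r ^ 2 * \<nu> * (w * x t ^ 3 + \<alpha> * w ^ 2 * K1 t + \<gamma> * w ^ 3 * K2 t))" for t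
  \<comment> \<open>Differentiability of \<open>x\<close> comes from the equation itself, which
    expresses \<open>x\<close> through antiderivatives.\<close>
  have x: "x = (\<lambda>t. - (p * w * J1 t + q * w ^ 2 * J2 t - s * w ^ 3 * J3 t
      + r ^ 2 * \<nu> * (w * K1 t + \<alpha> * w ^ 2 * K2 t + \<gamma> * w ^ 3 * K3 t)))"
    using eq by (intro ext) (simp add: algebra_simps eq_neg_iff_add_eq_0)
  have Dx: "(x has_real_derivative X' t) (at t)" for t
    by (subst x) (auto intro!: derivative_eq_intros D simp: X'_def)
  define Y' where "Y' t = - \<alpha> * X' t - q * w * x t + s * w ^ 2 * J1 t
      - r ^ 2 * \<nu> * (\<alpha> * w * x t ^ 3 + \<gamma> * w ^ 2 * K1 t)" for t
  have DY: "(Y has_real_derivative Y' t) (at t)" for t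
    unfolding Y_def Y'_def by (auto intro!: derivative_eq_intros D Dx)
  have DM: "(M has_real_derivative Y t) (at t)" for t
    unfolding Y_def M_def by (auto intro!: derivative_eq_intros D)
  have X': "X' t = w * (- \<nu> * (r ^ 2 * x t ^ 3 - \<mu> * x t) + Y t)" for t
    unfolding X'_def Y_def par(2) by (simp add: algebra_simps power2_eq_square power3_eq_cube)
  have Y': "Y' t = w * (\<nu> * k * x t - \<alpha> * Y t - \<gamma> * w * M t)" for t
  proof -
    \<comment> \<open>After substitution of \<open>p\<close>, \<open>q\<close> and \<open>s\<close>,
      the two sides of the claim differ by minus this product.\<close>
    have "\<gamma> * w * (x t + p * w * J1 t + q * w ^ 2 * J2 t - s * w ^ 3 * J3 t
      + r ^ 2 * \<nu> * (w * K1 t + \<alpha> * w ^ 2 * K2 t + \<gamma> * w ^ 3 * K3 t)) = 0"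
      unfolding eq by simp
    then show ?thesis
      unfolding Y'_def X'_def Y_def M_def par(2-4) by (simp add: algebra_simps power2_eq_square
          power3_eq_cube)
  qed
  show ?thesis unfolding solution_def
  proof
    fix t
    have 1: "((\<lambda>t. r * x (t / w)) has_vector_derivative r * (X' (t / w) / w)) (at t)"
      unfolding has_real_derivative_iff_has_vector_derivative[symmetric]
      by (auto intro!: derivative_eq_intros DERIV_chain'[OF _ Dx] nz)
    have 2: "((\<lambda>t. r / \<nu> * Y (t / w)) has_vector_derivative r / \<nu> * (Y' (t / w) / w)) (at t)"
      unfolding has_real_derivative_iff_has_vector_derivative[symmetric]
      by (auto intro!: derivative_eq_intros DERIV_chain'[OF _ DY] nz simp: field_simps)
    have 3: "((\<lambda>t. \<beta> * r * w / \<nu> * M (t / w)) has_vector_derivative \<beta> * r * w / \<nu> * (Y (t / w) /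
        w)) (at t)"
      unfolding has_real_derivative_iff_has_vector_derivative[symmetric]
      by (auto intro!: derivative_eq_intros DERIV_chain'[OF _ DM] nz)
    have "vector_field h k \<alpha> \<beta> \<mu> \<nu> (r * x (t / w), r / \<nu> * Y (t / w), \<beta> * r * w / \<nu> * M (t / w))
        = (r * (X' (t / w) / w), r / \<nu> * (Y' (t / w) / w), \<beta> * r * w / \<nu> * (Y (t / w) / w))"
      unfolding vector_field_def X' Y' par(1) using nz
      by (simp add: field_simps power2_eq_square power3_eq_cube)
    then show "((\<lambda>t. (r * x (t / w), r / \<nu> * Y (t / w), \<beta> * r * w / \<nu> * M (t / w)))
        has_vector_derivative
        vector_field h k \<alpha> \<beta> \<mu> \<nu> (r * x (t / w), r / \<nu> * Y (t / w), \<beta> * r * w / \<nu> * M (t / w)))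
            (at t)"
      using has_vector_derivative_Pair[OF 1 has_vector_derivative_Pair[OF 2 3]] by simp
  qed
qed

lemma antideriv_bc_DERIV:
  "antiperiodic (apply_bcontfun u) \<Longrightarrow> (apply_bcontfun (J u) has_real_derivative apply_bcontfun u t)
      (at t)"
  unfolding apply_antideriv_bc by (rule DERIV_antideriv) auto

text \<open>Common form of the three oscillatory hypotheses, in which \<open>h\<close> and
  \<open>\<beta>\<close> enter through their product at zero and its derivative
  \<open>h1 * \<beta> 0 + h 0 * \<beta>1\<close>. The limits of the coefficients give the profile,
  and the inequality makes its amplitude positive.\<close>

lemma small_oscillation:
  fixes h k \<alpha> \<beta> \<mu> \<nu> :: "real \<Rightarrow> real"
  assumes der: "(h has_real_derivative h1) (at 0)" "(k has_real_derivative k1) (at 0)"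
      "(\<alpha> has_real_derivative \<alpha>1) (at 0)" "(\<beta> has_real_derivative \<beta>1) (at 0)"
      "(\<mu> has_real_derivative \<mu>1) (at 0)" "(\<nu> has_real_derivative \<nu>1) (at 0)"
    and "\<omega> > 0" and h\<beta>: "h 0 * \<beta> 0 = 0" and \<alpha>: "\<alpha> 0 = \<mu> 0 * \<nu> 0"
    and k: "k 0 = - (((\<mu> 0)\<^sup>2 * (\<nu> 0)\<^sup>2 + \<omega>\<^sup>2) / \<nu> 0)"
    and pos: "0 < (\<omega>\<^sup>2 * (\<mu> 0 * \<nu>1 - \<alpha>1 + \<mu>1 * \<nu> 0) - (h1 * \<beta> 0 + h 0 * \<beta>1) * \<mu> 0 * \<nu> 0) * \<nu> 0"
  shows "\<exists>\<phi>. (\<forall>\<^sub>F \<epsilon> in at_right 0.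
      solution (vector_field (h \<epsilon>) (k \<epsilon>) (\<alpha> \<epsilon>) (\<beta> \<epsilon>) (\<mu> \<epsilon>) (\<nu> \<epsilon>)) (\<phi> \<epsilon>) \<and>
      periodic (\<phi> \<epsilon>) \<and> \<not> \<phi> \<epsilon> constant_on UNIV) \<and> uniform_limit UNIV \<phi> (\<lambda>_. 0) (at_right 0)"
proof -
  have \<nu>: "\<nu> 0 \<noteq> 0" using pos by auto
  define \<gamma> where "\<gamma> e = h e * \<beta> e" for e
  define p where "p e = \<alpha> e - \<nu> e * \<mu> e" for e
  define q where "q e = \<gamma> e - \<nu> e * k e - \<alpha> e * \<mu> e * \<nu> e" for e
  define s where "s e = \<gamma> e * \<nu> e * \<mu> e" for e
  note lim0 = der[THEN DERIV_tendsto_at_right]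
  have \<gamma>_lim: "(\<gamma> \<longlongrightarrow> 0) (at_right 0)"
    using tendsto_mult[OF lim0(1,4)] h\<beta> unfolding \<gamma>_def[abs_def] by simp
  have p_lim: "(p \<longlongrightarrow> 0) (at_right 0)"
    using tendsto_diff[OF lim0(3) tendsto_mult[OF lim0(6,5)]] \<alpha> unfolding p_def[abs_def] by
        (simp add: mult.commute)
  have s_lim: "(s \<longlongrightarrow> 0) (at_right 0)"
    using tendsto_mult[OF tendsto_mult[OF \<gamma>_lim lim0(6)] lim0(5)] unfolding s_def[abs_def] by simp
  have "(q \<longlongrightarrow> 0 - \<nu> 0 * k 0 - \<alpha> 0 * \<mu> 0 * \<nu> 0) (at_right 0)"
    unfolding q_def[abs_def] by (intro tendsto_intros \<gamma>_lim lim0)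
  moreover have "0 - \<nu> 0 * k 0 - \<alpha> 0 * \<mu> 0 * \<nu> 0 = \<omega>\<^sup>2"
    using \<nu> unfolding k \<alpha> by (simp add: field_simps power2_eq_square)
  ultimately have q_lim: "(q \<longlongrightarrow> \<omega>\<^sup>2) (at_right 0)" by simp
  obtain w a X d where w: "(w \<longlongrightarrow> 1 / \<omega>) (at_right 0)" and a: "(a \<longlongrightarrow> 0) (at_right 0)"
    and X: "(X \<longlongrightarrow> cos_bc) (at_right 0)" and d: "(d \<longlongrightarrow> \<nu> 0 * (3 / 4)) (at_right 0)"
    and prof: "\<forall>\<^sub>F e in at_right 0. antiperiodic (X e) \<and> fourier_cos (X e) = 1 \<and>
      a e * d e = - (p e + s e * w e ^ 2) \<and>
      X e + (p e * w e) *\<^sub>R J (X e) + (q e * w e ^ 2) *\<^sub>R J (J (X e)) - (s e * w e ^ 3) *\<^sub>R J (J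
          (J (X e)))
        + (a e * \<nu> e) *\<^sub>R (w e *\<^sub>R J (cube_bc (X e)) + (\<alpha> e * w e ^ 2) *\<^sub>R J (J (cube_bc (X e)))
          + (\<gamma> e * w e ^ 3) *\<^sub>R J (J (J (cube_bc (X e))))) = 0"
    using oscillation_profile[OF p_lim s_lim \<gamma>_lim q_lim lim0(3,6) \<open>\<omega> > 0\<close> \<nu>] by blast
  define \<gamma>1 where "\<gamma>1 = h1 * \<beta> 0 + h 0 * \<beta>1"
  have "(p has_real_derivative \<alpha>1 - (\<nu>1 * \<mu> 0 + \<mu>1 * \<nu> 0)) (at 0)"
    unfolding p_def[abs_def] by (intro derivative_intros der)
  then have p1: "((\<lambda>e. p e / e) \<longlongrightarrow> \<alpha>1 - (\<nu>1 * \<mu> 0 + \<mu>1 * \<nu> 0)) (at_right 0)"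
    by (rule DERIV_quotient_at_right) (simp add: p_def \<alpha>)
  have "(s has_real_derivative ((h1 * \<beta> 0 + \<beta>1 * h 0) * \<nu> 0 + \<nu>1 * (h 0 * \<beta> 0)) * \<mu> 0
      + \<mu>1 * (h 0 * \<beta> 0 * \<nu> 0)) (at 0)"
    unfolding s_def[abs_def] \<gamma>_def by (intro derivative_intros der)
  then have "(s has_real_derivative \<gamma>1 * \<nu> 0 * \<mu> 0) (at 0)"
    by (rule DERIV_cong) (unfold h\<beta> \<gamma>1_def, simp)
  then have s1: "((\<lambda>e. s e / e) \<longlongrightarrow> \<gamma>1 * \<nu> 0 * \<mu> 0) (at_right 0)"
    by (rule DERIV_quotient_at_right) (unfold s_def \<gamma>_def h\<beta>, simp)
  \<comment> \<open>Multiplied by \<open>d e / e\<close>, the relation for \<open>a e * d e\<close>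
    gives \<open>a e * (d e * d e) / e\<close>, whose limit is a positive multiple of the quantity
    assumed positive; so \<open>a e\<close> is positive too.\<close>
  have a_pos: "\<forall>\<^sub>F e in at_right 0. a e > 0"
  proof -
    have lim: "((\<lambda>e. - (p e / e + s e / e * w e ^ 2) * d e) \<longlongrightarrow>
        - ((\<alpha>1 - (\<nu>1 * \<mu> 0 + \<mu>1 * \<nu> 0)) + \<gamma>1 * \<nu> 0 * \<mu> 0 * (1 / \<omega>) ^ 2) * (\<nu> 0 * (3 / 4)))
            (at_right 0)"
      by (intro tendsto_intros p1 s1 w d)
    have "- ((\<alpha>1 - (\<nu>1 * \<mu> 0 + \<mu>1 * \<nu> 0)) + \<gamma>1 * \<nu> 0 * \<mu> 0 * (1 / \<omega>) ^ 2) * (\<nu> 0 * (3 / 4))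
      = 3 / (4 * \<omega>\<^sup>2) * ((\<omega>\<^sup>2 * (\<mu> 0 * \<nu>1 - \<alpha>1 + \<mu>1 * \<nu> 0) - \<gamma>1 * \<mu> 0 * \<nu> 0) * \<nu> 0)"
      using \<open>\<omega> > 0\<close> by (simp add: field_simps)
    moreover have "\<dots> > 0" using pos \<open>\<omega> > 0\<close> by (simp add: \<gamma>1_def)
    ultimately have "\<forall>\<^sub>F e in at_right 0. - (p e / e + s e / e * w e ^ 2) * d e > 0"
      by (intro order_tendstoD(1)[OF lim]) (simp only:)
    then show ?thesis using prof eventually_at_right_less[of 0]
    proof eventually_elim
      case (elim e)
      then have "a e * d e = - (p e + s e * w e ^ 2)" by blast
      then have "- (p e / e + s e / e * w e ^ 2) = a e * d e / e"
        by (simp only:) (simp add: add_divide_distrib diff_divide_distrib)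
      with elim(1) have "a e * (d e * d e) / e > 0" by (simp only:) (simp add: mult.assoc)
      then show ?case using elim(3) by (auto simp: zero_less_divide_iff zero_less_mult_iff)
    qed
  qed
  \<comment> \<open>\<open>Y\<close> and \<open>M\<close> are the functions of
    \<open>profile_solution\<close> for \<open>r = sqrt (a e)\<close>, taken in the Banach space so
    that they converge in norm.\<close>
  define Y where "Y e = - \<alpha> e *\<^sub>R X e - (q e * w e) *\<^sub>R J (X e) + (s e * w e ^ 2) *\<^sub>R J (J (X e))
    - (a e * \<nu> e) *\<^sub>R ((\<alpha> e * w e) *\<^sub>R J (cube_bc (X e)) + (\<gamma> e * w e ^ 2) *\<^sub>R J (J (cube_bc (X
        e))))" for e
  define M where "M e = - \<alpha> e *\<^sub>R J (X e) - (q e * w e) *\<^sub>R J (J (X e)) + (s e * w e ^ 2) *\<^sub>R J (J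
      (J (X e)))
    - (a e * \<nu> e) *\<^sub>R ((\<alpha> e * w e) *\<^sub>R J (J (cube_bc (X e))) + (\<gamma> e * w e ^ 2) *\<^sub>R J (J (J
        (cube_bc (X e)))))" for e
  define \<phi> where "\<phi> e t = (sqrt (a e) * X e (t / w e), sqrt (a e) / \<nu> e * Y e (t / w e),
    \<beta> e * sqrt (a e) * w e / \<nu> e * M e (t / w e))" for e t
  have w_pos: "\<forall>\<^sub>F e in at_right 0. w e > 0" using order_tendstoD(1)[OF w, of 0] \<open>\<omega> > 0\<close> by simp
  have \<nu>_nz: "\<forall>\<^sub>F e in at_right 0. \<nu> e \<noteq> 0" using tendsto_imp_eventually_ne[OF lim0(6) \<nu>] .
  have "\<forall>\<^sub>F e in at_right 0. solution (vector_field (h e) (k e) (\<alpha> e) (\<beta> e) (\<mu> e) (\<nu> e)) (\<phi> e) \<and>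
      periodic (\<phi> e) \<and> \<not> \<phi> e constant_on UNIV"
    using prof a_pos w_pos \<nu>_nz
  proof eventually_elim
    case (elim e)
    have X: "antiperiodic (X e)" and C: "antiperiodic (cube_bc (X e))"
      using elim by (auto simp: apply_cube_bc)
    note JX = antideriv_bc_antiperiodic[OF X]
    note JJX = antideriv_bc_antiperiodic[OF JX]
    note JC = antideriv_bc_antiperiodic[OF C]
    note JJC = antideriv_bc_antiperiodic[OF JC]
    note JJJX = antideriv_bc_antiperiodic[OF JJX]
    note JJJC = antideriv_bc_antiperiodic[OF JJC]
    have eq: "X e t + p e * w e * J (X e) t + q e * w e ^ 2 * J (J (X e)) t - s e * w e ^ 3 * J (J
        (J (X e))) t
        + sqrt (a e) ^ 2 * \<nu> e * (w e * J (cube_bc (X e)) t + \<alpha> e * w e ^ 2 * J (J (cube_bc (X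
            e))) t
          + \<gamma> e * w e ^ 3 * J (J (J (cube_bc (X e)))) t) = 0" for t
    proof -
      have "apply_bcontfun (X e + (p e * w e) *\<^sub>R J (X e) + (q e * w e ^ 2) *\<^sub>R J (J (X e))
          - (s e * w e ^ 3) *\<^sub>R J (J (J (X e)))
        + (a e * \<nu> e) *\<^sub>R (w e *\<^sub>R J (cube_bc (X e)) + (\<alpha> e * w e ^ 2) *\<^sub>R J (J (cube_bc (X e)))
          + (\<gamma> e * w e ^ 3) *\<^sub>R J (J (J (cube_bc (X e)))))) t = 0"
        using elim by simp
      moreover have "sqrt (a e) ^ 2 = a e" using elim by simp
      ultimately show ?thesis by simp
    qed
    have "(J (cube_bc (X e)) has_real_derivative X e t ^ 3) (at t)" for t
      using antideriv_bc_DERIV[OF C] by (simp add: apply_cube_bc)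
    from profile_solution[OF antideriv_bc_DERIV[OF X] antideriv_bc_DERIV[OF JX]
        antideriv_bc_DERIV[OF JJX]
        this antideriv_bc_DERIV[OF JC] antideriv_bc_DERIV[OF JJC] eq \<gamma>_def p_def q_def s_def] elim
    have "solution (vector_field (h e) (k e) (\<alpha> e) (\<beta> e) (\<mu> e) (\<nu> e)) (\<phi> e)"
      unfolding \<phi>_def[abs_def] Y_def M_def by simp
    moreover
    have per: "f (t + 2 * pi) = f t" if f: "antiperiodic f" for f :: "real \<Rightarrow> real" and t
    proof -
      have "f (t + 2 * pi) = f ((t + pi) + pi)" by (simp add: algebra_simps)
      also have "\<dots> = f t" by (simp only: f minus_minus)
      finally show ?thesis .
    qed
    have "antiperiodic (Y e)" "antiperiodic (M e)"
      using X C JX JJX JC JJC JJJX JJJC by (simp_all add: Y_def M_def algebra_simps)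
    note per = per[OF X] per[OF this(1)] per[OF this(2)]
    have "periodic (\<phi> e)" unfolding periodic_def
      by (rule exI[of _ "2 * pi * w e"]) (use elim per in \<open>auto simp: \<phi>_def add_divide_distrib\<close>)
    moreover have "\<not> \<phi> e constant_on UNIV"
    proof
      assume "\<phi> e constant_on UNIV"
      then obtain c where c: "\<And>t. \<phi> e t = c" unfolding constant_on_def by blast
      \<comment> \<open>A shift by half a period leaves a constant solution unchanged but negates
        \<open>X e\<close>; compare first components, where \<open>sqrt (a e)\<close> is
        nonzero.\<close>
      have "X e t = 0" for t
      proof -
        have "\<phi> e (t * w e) = \<phi> e ((t + pi) * w e)" by (simp add: c)
        then have "X e t = X e (t + pi)" using elim by (simp add: \<phi>_def)
        then show ?thesis using X by simp
      qed
      then have "fourier_cos (X e) = 0" by (simp add: fourier_cos_def)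
      then show False using elim by simp
    qed
    ultimately show ?case by blast
  qed
  \<comment> \<open>\<open>X\<close>, \<open>Y\<close> and \<open>M\<close> converge in the sup
    norm, while all three prefactors contain \<open>sqrt (a e)\<close>, which tends to zero.\<close>
  moreover have "uniform_limit UNIV \<phi> (\<lambda>_. 0) (at_right 0)"
  proof -
    note tJ = bounded_linear.tendsto[OF bounded_linear_J]
    have C: "((\<lambda>e. cube_bc (X e)) \<longlongrightarrow> cube_bc cos_bc) (at_right 0)"
      unfolding cube_bc_def by (intro bounded_bilinear.tendsto[OF bounded_bilinear_mult_bc] X)
    have r: "((\<lambda>e. sqrt (a e)) \<longlongrightarrow> 0) (at_right 0)"
      using tendsto_real_sqrt[OF a] by simp
    let ?c = "cube_bc cos_bc"
    have "(Y \<longlongrightarrow> - \<alpha> 0 *\<^sub>R cos_bc - (\<omega>\<^sup>2 * (1 / \<omega>)) *\<^sub>R J cos_bc + (0 * (1 / \<omega>) ^ 2) *\<^sub>R J (J cos_bc)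
        - (0 * \<nu> 0) *\<^sub>R ((\<alpha> 0 * (1 / \<omega>)) *\<^sub>R J ?c + (0 * (1 / \<omega>) ^ 2) *\<^sub>R J (J ?c))) (at_right 0)"
      unfolding Y_def[abs_def] by (intro tendsto_intros tJ C X lim0 w a q_lim s_lim \<gamma>_lim)
    then obtain l where l: "(Y \<longlongrightarrow> l) (at_right 0)" by blast
    have "(M \<longlongrightarrow> - \<alpha> 0 *\<^sub>R J cos_bc - (\<omega>\<^sup>2 * (1 / \<omega>)) *\<^sub>R J (J cos_bc) + (0 * (1 / \<omega>) ^ 2) *\<^sub>R J (J
        (J cos_bc))
        - (0 * \<nu> 0) *\<^sub>R ((\<alpha> 0 * (1 / \<omega>)) *\<^sub>R J (J ?c) + (0 * (1 / \<omega>) ^ 2) *\<^sub>R J (J (J ?c))))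
            (at_right 0)"
      unfolding M_def[abs_def] by (intro tendsto_intros tJ C X lim0 w a q_lim s_lim \<gamma>_lim)
    then obtain m where m: "(M \<longlongrightarrow> m) (at_right 0)" by blast
    have "((\<lambda>e. \<bar>sqrt (a e)\<bar> * norm (X e) + \<bar>sqrt (a e) / \<nu> e\<bar> * norm (Y e)
        + \<bar>\<beta> e * sqrt (a e) * w e / \<nu> e\<bar> * norm (M e)) \<longlongrightarrow>
        \<bar>0\<bar> * norm cos_bc + \<bar>0 / \<nu> 0\<bar> * norm l + \<bar>\<beta> 0 * 0 * (1 / \<omega>) / \<nu> 0\<bar> * norm m) (at_right 0)"
      by (intro tendsto_intros r X l m lim0 w \<nu>)
    then have B: "((\<lambda>e. \<bar>sqrt (a e)\<bar> * norm (X e) + \<bar>sqrt (a e) / \<nu> e\<bar> * norm (Y e)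
        + \<bar>\<beta> e * sqrt (a e) * w e / \<nu> e\<bar> * norm (M e)) \<longlongrightarrow> 0) (at_right 0)" by simp
    have le: "norm (\<phi> e t) \<le> \<bar>sqrt (a e)\<bar> * norm (X e) + \<bar>sqrt (a e) / \<nu> e\<bar> * norm (Y e)
        + \<bar>\<beta> e * sqrt (a e) * w e / \<nu> e\<bar> * norm (M e)" for e t
    proof -
      have bd: "norm (c * apply_bcontfun f t) \<le> \<bar>c\<bar> * norm f" for c f t
        unfolding norm_mult using norm_bounded[of f t] by (simp add: mult_left_mono)
      have "norm (\<phi> e t) \<le> norm (sqrt (a e) * X e (t / w e)) + (norm (sqrt (a e) / \<nu> e * Y e (t /
          w e))
          + norm (\<beta> e * sqrt (a e) * w e / \<nu> e * M e (t / w e)))"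
        unfolding \<phi>_def by (rule order_trans[OF norm_Pair_le add_left_mono[OF norm_Pair_le]])
      also have "\<dots> \<le> \<bar>sqrt (a e)\<bar> * norm (X e) + (\<bar>sqrt (a e) / \<nu> e\<bar> * norm (Y e)
        + \<bar>\<beta> e * sqrt (a e) * w e / \<nu> e\<bar> * norm (M e))"
        by (intro add_mono bd)
      finally show ?thesis by simp
    qed
    show ?thesis unfolding uniform_limit_iff
    proof (intro allI impI)
      fix \<eta> :: real assume "\<eta> > 0"
      from order_tendstoD(2)[OF B this]
      show "\<forall>\<^sub>F e in at_right 0. \<forall>t\<in>UNIV. dist (\<phi> e t) 0 < \<eta>"
        by eventually_elim (auto intro: order.strict_trans1[OF le])
    qed
  qed
  ultimately show ?thesis by blast
qed

text \<open>With \<open>y = 0\<close> the vector field vanishes where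
  \<open>x ^ 3 = \<mu> * x\<close> and \<open>h * z = k * x\<close>. The slope \<open>\<mu>1\<close>
  makes \<open>\<mu> \<epsilon>\<close> positive for small positive parameters, so
  \<open>sqrt (\<mu> \<epsilon>)\<close> is a nonzero root; constants are periodic.\<close>

lemma nontrivial_equilibrium:
  fixes h k \<alpha> \<beta> \<mu> \<nu> :: "real \<Rightarrow> real"
  assumes der: "(h has_real_derivative h1) (at 0)" "(k has_real_derivative k1) (at 0)"
      "(\<mu> has_real_derivative \<mu>1) (at 0)" and "\<mu>1 > 0" "h 0 \<noteq> 0" "\<mu> 0 = 0"
  shows "\<exists>\<phi>. (\<forall>\<^sub>F \<epsilon> in at_right 0.
      solution (vector_field (h \<epsilon>) (k \<epsilon>) (\<alpha> \<epsilon>) (\<beta> \<epsilon>) (\<mu> \<epsilon>) (\<nu> \<epsilon>)) (\<phi> \<epsilon>) \<and>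
      periodic (\<phi> \<epsilon>) \<and> (\<exists>t. \<phi> \<epsilon> t \<noteq> 0)) \<and> uniform_limit UNIV \<phi> (\<lambda>_. 0) (at_right 0)"
proof -
  define e where "e \<epsilon> = (sqrt (\<mu> \<epsilon>), 0 :: real, k \<epsilon> * sqrt (\<mu> \<epsilon>) / h \<epsilon>)" for \<epsilon>
  have "(e \<longlongrightarrow> (sqrt (\<mu> 0), 0, k 0 * sqrt (\<mu> 0) / h 0)) (at_right 0)"
    unfolding e_def[abs_def] by (intro tendsto_intros der[THEN DERIV_tendsto_at_right] assms)
  then have "(e \<longlongrightarrow> 0) (at_right 0)" using assms by (simp add: zero_prod_def)
  then have "uniform_limit UNIV (\<lambda>\<epsilon> t :: real. e \<epsilon>) (\<lambda>_. 0) (at_right 0)"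
    by (auto simp: uniform_limit_iff tendsto_iff)
  moreover have "((\<lambda>\<epsilon>. \<mu> \<epsilon> / \<epsilon>) \<longlongrightarrow> \<mu>1) (at_right 0)"
    by (rule DERIV_quotient_at_right) fact+
  from order_tendstoD(1)[OF this \<open>\<mu>1 > 0\<close>] tendsto_imp_eventually_ne[OF DERIV_tendsto_at_right[OF
      der(1)] \<open>h 0 \<noteq> 0\<close>]
    eventually_at_right_less[of 0]
  have "\<forall>\<^sub>F \<epsilon> in at_right 0.
      solution (vector_field (h \<epsilon>) (k \<epsilon>) (\<alpha> \<epsilon>) (\<beta> \<epsilon>) (\<mu> \<epsilon>) (\<nu> \<epsilon>)) (\<lambda>t. e \<epsilon>) \<and>
      periodic (\<lambda>t :: real. e \<epsilon>) \<and> (\<exists>t :: real. e \<epsilon> \<noteq> 0)"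
  proof eventually_elim
    case (elim \<epsilon>)
    then have \<mu>: "\<mu> \<epsilon> > 0" by (simp add: zero_less_divide_iff)
    then have "vector_field (h \<epsilon>) (k \<epsilon>) (\<alpha> \<epsilon>) (\<beta> \<epsilon>) (\<mu> \<epsilon>) (\<nu> \<epsilon>) (e \<epsilon>) = 0"
      using elim by (simp add: vector_field_def e_def zero_prod_def power3_eq_cube)
    moreover have "e \<epsilon> \<noteq> 0" using \<mu> by (simp add: e_def zero_prod_def)
    ultimately show ?case
      by (simp add: solution_def periodic_def gt_ex)
  qed
  ultimately show ?thesis by (intro exI[of _ "\<lambda>\<epsilon> t. e \<epsilon>"]) simp
qed

theorem theorem2:
  fixes \<omega> :: real and h k \<alpha> \<beta> \<mu> \<nu> :: "real \<Rightarrow> real"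
  assumes "\<omega> > 0"
    and "smooth_near_0 h" "smooth_near_0 k" "smooth_near_0 \<alpha>"
        "smooth_near_0 \<beta>" "smooth_near_0 \<mu>" "smooth_near_0 \<nu>"
    and "H1 \<omega> h k \<alpha> \<beta> \<mu> \<nu> \<or> H2 \<omega> h k \<alpha> \<beta> \<mu> \<nu> \<or>
         H3 \<omega> h k \<alpha> \<beta> \<mu> \<nu> \<or> H4 \<omega> h k \<alpha> \<beta> \<mu> \<nu>"
  shows "\<exists>\<epsilon>\<^sub>0>0. \<exists>\<phi> :: real \<Rightarrow> real \<Rightarrow> real \<times> real \<times> real.
    (\<forall>\<epsilon>\<in>{0<..<\<epsilon>\<^sub>0}.
       solution (vector_field (h \<epsilon>) (k \<epsilon>) (\<alpha> \<epsilon>) (\<beta> \<epsilon>) (\<mu> \<epsilon>) (\<nu> \<epsilon>)) (\<phi> \<epsilon>) \<and>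
       periodic (\<phi> \<epsilon>) \<and>
       (\<exists>t. \<phi> \<epsilon> t \<noteq> 0) \<and>
       (\<not> H3 \<omega> h k \<alpha> \<beta> \<mu> \<nu> \<longrightarrow> \<not> \<phi> \<epsilon> constant_on UNIV)) \<and>
    uniform_limit UNIV \<phi> (\<lambda>_. 0) (at_right 0)"
proof -
  note der = assms(2-7)[THEN smooth_near_0_DERIV]
  have "\<exists>\<phi> :: real \<Rightarrow> real \<Rightarrow> real \<times> real \<times> real. (\<forall>\<^sub>F \<epsilon> in at_right 0.
      solution (vector_field (h \<epsilon>) (k \<epsilon>) (\<alpha> \<epsilon>) (\<beta> \<epsilon>) (\<mu> \<epsilon>) (\<nu> \<epsilon>)) (\<phi> \<epsilon>) \<and>
      periodic (\<phi> \<epsilon>) \<and> (\<exists>t. \<phi> \<epsilon> t \<noteq> 0) \<and>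
      (\<not> H3 \<omega> h k \<alpha> \<beta> \<mu> \<nu> \<longrightarrow> \<not> \<phi> \<epsilon> constant_on UNIV)) \<and> uniform_limit UNIV \<phi> (\<lambda>_. 0) (at_right 0)"
  proof (cases "H3 \<omega> h k \<alpha> \<beta> \<mu> \<nu>")
    case True
    \<comment> \<open>This is a factor of the positive \<open>\<delta>3\<close>, so
      \<open>\<mu>1 \<ge> 0\<close> becomes strict; \<open>h 0\<close> is a factor as well.\<close>
    then have "sqrt (taylor_coeff \<mu> 1) \<noteq> 0" unfolding H3_def Let_def by auto
    then have "taylor_coeff \<mu> 1 > 0" "h 0 \<noteq> 0" "\<mu> 0 = 0"
      using True unfolding H3_def Let_def taylor_coeff_0 by auto
    then obtain \<phi> where "\<forall>\<^sub>F \<epsilon> in at_right 0.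
        solution (vector_field (h \<epsilon>) (k \<epsilon>) (\<alpha> \<epsilon>) (\<beta> \<epsilon>) (\<mu> \<epsilon>) (\<nu> \<epsilon>)) (\<phi> \<epsilon>) \<and>
        periodic (\<phi> \<epsilon>) \<and> (\<exists>t. \<phi> \<epsilon> t \<noteq> 0)" "uniform_limit UNIV \<phi> (\<lambda>_. 0) (at_right 0)"
      using nontrivial_equilibrium[OF der(1,2,5)] by blast
    with True show ?thesis by (intro exI[of _ \<phi>]) (auto elim: eventually_mono)
  next
    case False
    let ?T = taylor_coeff
    have "h 0 * \<beta> 0 = 0 \<and> \<alpha> 0 = \<mu> 0 * \<nu> 0 \<and>
        k 0 = - (((\<mu> 0)\<^sup>2 * (\<nu> 0)\<^sup>2 + \<omega>\<^sup>2) / \<nu> 0) \<and>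
        0 < (\<omega>\<^sup>2 * (\<mu> 0 * ?T \<nu> 1 - ?T \<alpha> 1 + ?T \<mu> 1 * \<nu> 0)
          - (?T h 1 * \<beta> 0 + h 0 * ?T \<beta> 1) * \<mu> 0 * \<nu> 0) * \<nu> 0"
      using assms(8)
    proof (elim disjE)
      assume "H4 \<omega> h k \<alpha> \<beta> \<mu> \<nu>"
      then have "h 0 = 0" "\<mu> 0 = 0" "\<alpha> 0 = 0" "k 0 = - (\<omega>\<^sup>2 / \<nu> 0)"
        "\<nu> 0 * (?T \<mu> 1 * \<nu> 0 - ?T \<alpha> 1) > 0"
        unfolding H4_def Let_def taylor_coeff_0 by auto
      \<comment> \<open>Multiplication by \<open>\<omega>\<^sup>2\<close> brings the inequality to
        the common form, in which the terms with \<open>\<mu> 0\<close> vanish.\<close>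
      moreover from mult_pos_pos[OF zero_less_power[OF assms(1), of 2] this(5)]
      have "(\<omega>\<^sup>2 * (- ?T \<alpha> 1 + ?T \<mu> 1 * \<nu> 0)) * \<nu> 0 > 0" by (simp add: algebra_simps)
      ultimately show ?thesis by simp
    next
      assume "H1 \<omega> h k \<alpha> \<beta> \<mu> \<nu>"
      then show ?thesis
        unfolding H1_def Let_def taylor_coeff_0 by (simp add: mult.commute[of "\<beta> 0"])
    next
      assume "H2 \<omega> h k \<alpha> \<beta> \<mu> \<nu>"
      then show ?thesis
        unfolding H2_def Let_def taylor_coeff_0 by (simp add: mult.commute[of "?T \<beta> (Suc 0)"])
    qed (use False in simp)
    then obtain \<phi> where \<phi>: "\<forall>\<^sub>F \<epsilon> in at_right 0.
        solution (vector_field (h \<epsilon>) (k \<epsilon>) (\<alpha> \<epsilon>) (\<beta> \<epsilon>) (\<mu> \<epsilon>) (\<nu> \<epsilon>)) (\<phi> \<epsilon>) \<and>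
        periodic (\<phi> \<epsilon>) \<and> \<not> \<phi> \<epsilon> constant_on UNIV" "uniform_limit UNIV \<phi> (\<lambda>_. 0) (at_right 0)"
      using small_oscillation[OF der assms(1)] by blast
    have "\<exists>t. \<phi> \<epsilon> t \<noteq> 0" if "\<not> \<phi> \<epsilon> constant_on UNIV" for \<epsilon>
      using that unfolding constant_on_def by blast
    with \<phi> show ?thesis by (intro exI[of _ \<phi>]) (auto elim: eventually_mono)
  qed
  then obtain \<phi> :: "real \<Rightarrow> real \<Rightarrow> real \<times> real \<times> real" where \<phi>: "\<forall>\<^sub>F \<epsilon> in at_right 0.
      solution (vector_field (h \<epsilon>) (k \<epsilon>) (\<alpha> \<epsilon>) (\<beta> \<epsilon>) (\<mu> \<epsilon>) (\<nu> \<epsilon>)) (\<phi> \<epsilon>) \<and>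
      periodic (\<phi> \<epsilon>) \<and> (\<exists>t. \<phi> \<epsilon> t \<noteq> 0) \<and>
      (\<not> H3 \<omega> h k \<alpha> \<beta> \<mu> \<nu> \<longrightarrow> \<not> \<phi> \<epsilon> constant_on UNIV)" (is "eventually ?P _")
    and lim: "uniform_limit UNIV \<phi> (\<lambda>_. 0) (at_right 0)" by blast
  from \<phi> obtain \<epsilon>\<^sub>0 where "\<epsilon>\<^sub>0 > 0" "\<forall>\<epsilon>>0. \<epsilon> < \<epsilon>\<^sub>0 \<longrightarrow> ?P \<epsilon>"
    unfolding eventually_at_right_field by blast
  then have "\<forall>\<epsilon>\<in>{0<..<\<epsilon>\<^sub>0}. ?P \<epsilon>" by simp
  with lim \<open>\<epsilon>\<^sub>0 > 0\<close> show ?thesis by blast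
qed

end
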